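(* Let $L$ be a (left) Leibniz algebra over $\mathfrak{k}$ with left center $Z$, let $H\supseteq Z$ be an isotropic ideal of $L$, and let $(V,\tau)$ be an $H$-representation of $L$. Then $$H^{\bullet}(L,H,V)\cong H_{CE}^{\bullet}(L/H,V).$$
   Context: Throughout $\mathfrak{k}=\mathbb{R}$ or $\mathbb{C}$; a hat denotes omission. A (left) Leibniz algebra is a $\mathfrak{k}$-vector space $L$ with a bilinear bracket $\circ$ satisfying $e_1\circ(e_2\circ e_3)=(e_1\circ e_2)\circ e_3+e_2\circ(e_1\circ e_3)$. Its left center is $Z=\{e\in L: e\circ e'=0\ \forall e'\in L\}$. The symmetric product $(e_1,e_2)=e_1\circ e_2+e_2\circ e_1$ takes values in $Z$. An isotropic ideal $H$ is a subspace with $e\circ h,\ h\circ e\in H$ for all $e\in L,h\in H$, and $(h,h')=0$ for all $h,h'\in H$. An $H$-representation of $L$ is a vector space $V$ with a linear map $\tau:L\to gl(V)$ such that $\tau(e_1\circ e_2)=[\tau(e_1),\tau(e_2)]$ and $\tau(h)=0$ for all $h\in H$. $C^n(L,H,V)$ is the space of sequences $\omega=(\omega_0,\dots,\omega_{[n/2]})$ of linear maps $\omega_k:(\otimes^{n-2k}L)\otimes(\odot^kH)\to V$ ($\odot^k$ the symmetric power; set $\omega_k=0$ for $k>[n/2]$ or $k<0$) such that for all $k$ and all $i$: $\omega_k(e_1,\dots,e_i,e_{i+1},\dots,e_{n-2k};h_1,\dots,h_k)+\omega_k(e_1,\dots,e_{i+1},e_i,\dots,e_{n-2k};h_1,\dots,h_k)=-\omega_{k+1}(e_1,\dots,\widehat{e_i},\widehat{e_{i+1}},\dots,e_{n-2k};(e_i,e_{i+1}),h_1,\dots,h_k)$.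 The $H$-standard complex is $C^\bullet(L,H,V)=\bigoplus_nC^n(L,H,V)$ with $d=d_0+\delta+d'$, where for $\omega\in C^n(L,H,V)$ and $0\le k\le[(n+1)/2]$: $(d_0\omega)_k(e_1,\dots,e_{n+1-2k};h_1,\dots,h_k)=\sum_a(-1)^{a+1}\tau(e_a)\omega_k(\dots,\widehat{e_a},\dots;h_1,\dots,h_k)+\sum_{a<b}(-1)^a\omega_k(\dots,\widehat{e_a},\dots,e_a\circ e_b,\dots;h_1,\dots,h_k)$, with $e_a\circ e_b$ in the place of $e_b$; $(\delta\omega)_k(e_1,\dots,e_{n+1-2k};h_1,\dots,h_k)=\sum_j\omega_{k-1}(h_j,e_1,\dots,e_{n+1-2k};h_1,\dots,\widehat{h_j},\dots,h_k)$ (zero for $k=0$); $(d'\omega)_k(e_1,\dots,e_{n+1-2k};h_1,\dots,h_k)=\sum_{a,j}(-1)^{a+1}\omega_k(\dots,\widehat{e_a},\dots;h_1,\dots,\widehat{h_j},h_j\circ e_a,\dots,h_k)$, with $h_j\circ e_a$ in the place of $h_j$. This is a cochain complex; its cohomology is $H^\bullet(L,H,V)$, the $H$-standard cohomology. Since $H\supseteq Z$, the quotient $L/H$ with the induced bracket is a Lie algebra, and $\tau$ induces a representation of it on $V$; $H_{CE}^\bullet(L/H,V)$ is the usual Chevalley-Eilenberg cohomology of this Lie algebra with coefficients in $V$. *)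

theory Defs
  imports Complex_Main "HOL-Library.Multiset" "HOL-Library.NList"
    "HOL-Library.Set_Algebras" "HOL-Library.Function_Algebras"
begin

section \<open>The ground field\<close>

text \<open>The scalars are a type that is, as a field, either the reals or the complex numbers.\<close>

class real_or_complex = field +
  assumes real_or_complex:
    "(\<exists>f :: 'a \<Rightarrow> real. bij f \<and> (\<forall>x y. f (x + y) = f x + f y \<and> f (x * y) = f x * f y)) \<or>
     (\<exists>f :: 'a \<Rightarrow> complex. bij f \<and> (\<forall>x y. f (x + y) = f x + f y \<and> f (x * y) = f x * f y))"

instance real :: real_or_complex
  by standard (intro disjI1 exI[of _ id], simp)

instance complex :: real_or_complex
  by standard (intro disjI2 exI[of _ id], simp)


section \<open>Vector spaces with a carrier, quotients, cohomology\<close>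

record ('k, 'v) vspace =
  vcarrier :: "'v set"
  vadd :: "'v \<Rightarrow> 'v \<Rightarrow> 'v"
  vsmult :: "'k \<Rightarrow> 'v \<Rightarrow> 'v"

definition subspace_vspace ::
    "('k \<Rightarrow> 'v \<Rightarrow> 'v) \<Rightarrow> 'v set \<Rightarrow> ('k, 'v::ab_group_add) vspace" where
  "subspace_vspace s W = \<lparr>vcarrier = W, vadd = (+), vsmult = s\<rparr>"

text \<open>In the quotient \<open>A / B\<close> the vectors are the cosets \<open>a +o B\<close>, added elementwise.
  In the scalar multiple the summand \<open>B\<close> matters only for the scalar 0, where
  the image of a coset is \<open>{0}\<close> instead of \<open>B\<close>.\<close>

definition coset_smult ::
    "('k \<Rightarrow> 'v \<Rightarrow> 'v) \<Rightarrow> 'v::ab_group_add set \<Rightarrow> 'k \<Rightarrow> 'v set \<Rightarrow> 'v set" where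
  "coset_smult s B c X = s c ` X + B"

definition quotient_vspace ::
    "('k \<Rightarrow> 'v \<Rightarrow> 'v) \<Rightarrow> 'v::ab_group_add set \<Rightarrow> 'v set \<Rightarrow> ('k, 'v set) vspace" where
  "quotient_vspace s A B =
     \<lparr>vcarrier = (\<lambda>a. a +o B) ` A, vadd = (+), vsmult = coset_smult s B\<rparr>"

definition vspace_isomorphic :: "('k, 'v) vspace \<Rightarrow> ('k, 'w) vspace \<Rightarrow> bool" where
  "vspace_isomorphic X Y \<longleftrightarrow>
     (\<exists>\<Phi>. bij_betw \<Phi> (vcarrier X) (vcarrier Y) \<and>
        (\<forall>x\<in>vcarrier X. \<forall>y\<in>vcarrier X. \<Phi> (vadd X x y) = vadd Y (\<Phi> x) (\<Phi> y)) \<and>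
        (\<forall>c. \<forall>x\<in>vcarrier X. \<Phi> (vsmult X c x) = vsmult Y c (\<Phi> x)))"

text \<open>The cohomology of \<open>0 \<rightarrow> C 0 \<rightarrow> C 1 \<rightarrow> \<dots>\<close> with \<open>d n\<close> defined on \<open>C n\<close>.\<close>

definition cocycles :: "(nat \<Rightarrow> 'c set) \<Rightarrow> (nat \<Rightarrow> 'c \<Rightarrow> 'c::ab_group_add) \<Rightarrow> nat \<Rightarrow> 'c set" where
  "cocycles C d n = {\<omega> \<in> C n. d n \<omega> = 0}"

definition coboundaries :: "(nat \<Rightarrow> 'c set) \<Rightarrow> (nat \<Rightarrow> 'c \<Rightarrow> 'c::ab_group_add) \<Rightarrow> nat \<Rightarrow> 'c set" where
  "coboundaries C d n = (case n of 0 \<Rightarrow> {0} | Suc m \<Rightarrow> d m ` C m)"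

definition cohomology ::
    "('k \<Rightarrow> 'c \<Rightarrow> 'c) \<Rightarrow> (nat \<Rightarrow> 'c set) \<Rightarrow> (nat \<Rightarrow> 'c \<Rightarrow> 'c::ab_group_add) \<Rightarrow> nat
      \<Rightarrow> ('k, 'c set) vspace" where
  "cohomology s C d n = quotient_vspace s (cocycles C d n) (coboundaries C d n)"

text \<open>Linear maps out of a tensor power are given as multilinear functions of the list of
  tensor factors.\<close>

definition multilinear ::
    "('k, 'g, 'z) vspace_scheme \<Rightarrow> ('k \<Rightarrow> 'v \<Rightarrow> 'v) \<Rightarrow> nat \<Rightarrow> ('g list \<Rightarrow> 'v::ab_group_add) \<Rightarrow> bool" where
  "multilinear X s m f \<longleftrightarrow>
     (\<forall>xs \<in> nlists m (vcarrier X). \<forall>i<m. \<forall>x\<in>vcarrier X. \<forall>y\<in>vcarrier X. \<forall>c.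
        f (xs[i := vadd X x y]) = f (xs[i := x]) + f (xs[i := y]) \<and>
        f (xs[i := vsmult X c x]) = s c (f (xs[i := x])))"

definition omit :: "nat \<Rightarrow> 'x list \<Rightarrow> 'x list" where
  "omit i xs = take i xs @ drop (Suc i) xs"


section \<open>Leibniz algebras, isotropic ideals, representations\<close>

locale leibniz_algebra = vector_space sL
  for sL :: "'k::field \<Rightarrow> 'l::ab_group_add \<Rightarrow> 'l" +
  fixes br :: "'l \<Rightarrow> 'l \<Rightarrow> 'l"
  assumes br_linear_right: "Vector_Spaces.linear sL sL (\<lambda>y. br x y)"
    and br_linear_left: "Vector_Spaces.linear sL sL (\<lambda>x. br x y)"
    and leibniz: "br x (br y z) = br (br x y) z + br y (br x z)"

definition left_center :: "('l \<Rightarrow> 'l \<Rightarrow> 'l::ab_group_add) \<Rightarrow> 'l set" where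
  "left_center br = {e. \<forall>e'. br e e' = 0}"

definition symprod :: "('l \<Rightarrow> 'l \<Rightarrow> 'l::ab_group_add) \<Rightarrow> 'l \<Rightarrow> 'l \<Rightarrow> 'l" where
  "symprod br x y = br x y + br y x"

locale isotropic_ideal = leibniz_algebra sL br
  for sL :: "'k::field \<Rightarrow> 'l::ab_group_add \<Rightarrow> 'l" and br :: "'l \<Rightarrow> 'l \<Rightarrow> 'l" +
  fixes H :: "'l set"
  assumes subspace_H: "subspace H"
    and ideal_right: "h \<in> H \<Longrightarrow> br e h \<in> H"
    and ideal_left: "h \<in> H \<Longrightarrow> br h e \<in> H"
    and isotropic: "h \<in> H \<Longrightarrow> h' \<in> H \<Longrightarrow> symprod br h h' = 0"

locale H_representation = isotropic_ideal sL br H + V: vector_space sV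
  for sL :: "'k::field \<Rightarrow> 'l::ab_group_add \<Rightarrow> 'l" and br :: "'l \<Rightarrow> 'l \<Rightarrow> 'l"
    and H :: "'l set" and sV :: "'k \<Rightarrow> 'v::ab_group_add \<Rightarrow> 'v" +
  fixes \<tau> :: "'l \<Rightarrow> 'v \<Rightarrow> 'v"
  assumes tau_endo: "Vector_Spaces.linear sV sV (\<tau> e)"
    and tau_add: "\<tau> (e + e') v = \<tau> e v + \<tau> e' v"
    and tau_scale: "\<tau> (sL c e) v = sV c (\<tau> e v)"
    and tau_bracket: "\<tau> (br e e') v = \<tau> e (\<tau> e' v) - \<tau> e' (\<tau> e v)"
    and tau_H: "h \<in> H \<Longrightarrow> \<tau> h v = 0"


section \<open>The \<open>H\<close>-standard complex\<close>

text \<open>A cochain \<open>\<omega>\<close> is the family of its components; \<open>\<omega> k es hs\<close> is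
  $\omega_k(e_1,\dots,e_{n-2k};h_1,\dots,h_k)$. All values outside the domain of the
  components, in particular those for \<open>k > n div 2\<close>, are set to 0, so that equality of
  functions is equality of cochains. Indices of list entries start at 0.\<close>

type_synonym ('l, 'v) Hcochain = "nat \<Rightarrow> 'l list \<Rightarrow> 'l list \<Rightarrow> 'v"

definition Hdom :: "'l set \<Rightarrow> nat \<Rightarrow> nat \<Rightarrow> 'l list \<Rightarrow> 'l list \<Rightarrow> bool" where
  "Hdom H n k es hs \<longleftrightarrow> k \<le> n div 2 \<and> length es = n - 2 * k \<and> hs \<in> nlists k H"

definition Hcochains ::
    "('k \<Rightarrow> 'l \<Rightarrow> 'l) \<Rightarrow> ('l \<Rightarrow> 'l \<Rightarrow> 'l) \<Rightarrow> 'l set \<Rightarrow> ('k \<Rightarrow> 'v \<Rightarrow> 'v) \<Rightarrow> nat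
      \<Rightarrow> ('l::ab_group_add, 'v::ab_group_add) Hcochain set" where
  "Hcochains sL br H sV n = {\<omega>.
     (\<forall>k es hs. \<not> Hdom H n k es hs \<longrightarrow> \<omega> k es hs = 0) \<and>
     (\<forall>k \<le> n div 2. \<forall>hs \<in> nlists k H.
        multilinear (subspace_vspace sL UNIV) sV (n - 2 * k) (\<lambda>es. \<omega> k es hs)) \<and>
     (\<forall>k \<le> n div 2. \<forall>es \<in> nlists (n - 2 * k) UNIV.
        multilinear (subspace_vspace sL H) sV k (\<lambda>hs. \<omega> k es hs)) \<and>
     (\<forall>k es hs hs'. mset hs = mset hs' \<longrightarrow> \<omega> k es hs = \<omega> k es hs') \<and>
     (\<forall>k xs a b ys hs. Hdom H n k (xs @ a # b # ys) hs \<longrightarrow>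
        \<omega> k (xs @ a # b # ys) hs + \<omega> k (xs @ b # a # ys) hs
          = - \<omega> (Suc k) (xs @ ys) (symprod br a b # hs))}"

definition Hscale :: "('k \<Rightarrow> 'v \<Rightarrow> 'v) \<Rightarrow> 'k \<Rightarrow> ('l, 'v) Hcochain \<Rightarrow> ('l, 'v) Hcochain" where
  "Hscale sV c \<omega> = (\<lambda>k es hs. sV c (\<omega> k es hs))"

definition Hd0 ::
    "('l \<Rightarrow> 'l \<Rightarrow> 'l) \<Rightarrow> ('k::field \<Rightarrow> 'v \<Rightarrow> 'v) \<Rightarrow> ('l \<Rightarrow> 'v \<Rightarrow> 'v)
      \<Rightarrow> ('l, 'v::ab_group_add) Hcochain \<Rightarrow> ('l, 'v) Hcochain" where
  "Hd0 br sV \<tau> \<omega> k es hs =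
     (\<Sum>a<length es. sV ((-1) ^ a) (\<tau> (es ! a) (\<omega> k (omit a es) hs))) +
     (\<Sum>b<length es. \<Sum>a<b.
        sV ((-1) ^ Suc a) (\<omega> k (omit a (es[b := br (es ! a) (es ! b)])) hs))"

definition Hdelta :: "('l, 'v::ab_group_add) Hcochain \<Rightarrow> ('l, 'v) Hcochain" where
  "Hdelta \<omega> k es hs =
     (if k = 0 then 0 else (\<Sum>j<length hs. \<omega> (k - 1) (hs ! j # es) (omit j hs)))"

definition Hdprime ::
    "('l \<Rightarrow> 'l \<Rightarrow> 'l) \<Rightarrow> ('k::field \<Rightarrow> 'v \<Rightarrow> 'v)
      \<Rightarrow> ('l, 'v::ab_group_add) Hcochain \<Rightarrow> ('l, 'v) Hcochain" where
  "Hdprime br sV \<omega> k es hs =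
     (\<Sum>a<length es. \<Sum>j<length hs.
        sV ((-1) ^ a) (\<omega> k (omit a es) (hs[j := br (hs ! j) (es ! a)])))"

definition Hdiff ::
    "('l \<Rightarrow> 'l \<Rightarrow> 'l) \<Rightarrow> 'l set \<Rightarrow> ('k::field \<Rightarrow> 'v \<Rightarrow> 'v) \<Rightarrow> ('l \<Rightarrow> 'v \<Rightarrow> 'v) \<Rightarrow> nat
      \<Rightarrow> ('l, 'v::ab_group_add) Hcochain \<Rightarrow> ('l, 'v) Hcochain" where
  "Hdiff br H sV \<tau> n \<omega> = (\<lambda>k es hs.
     if Hdom H (Suc n) k es hs
     then Hd0 br sV \<tau> \<omega> k es hs + Hdelta \<omega> k es hs + Hdprime br sV \<omega> k es hs
     else 0)"

definition H_standard_cohomology ::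
    "('k::field \<Rightarrow> 'l \<Rightarrow> 'l) \<Rightarrow> ('l \<Rightarrow> 'l \<Rightarrow> 'l) \<Rightarrow> 'l set \<Rightarrow> ('k \<Rightarrow> 'v \<Rightarrow> 'v) \<Rightarrow> ('l \<Rightarrow> 'v \<Rightarrow> 'v)
      \<Rightarrow> nat \<Rightarrow> ('k, ('l::ab_group_add, 'v::ab_group_add) Hcochain set) vspace" where
  "H_standard_cohomology sL br H sV \<tau> =
     cohomology (Hscale sV) (Hcochains sL br H sV) (Hdiff br H sV \<tau>)"


section \<open>Chevalley-Eilenberg cohomology\<close>

record ('k, 'g) liealg = "('k, 'g) vspace" +
  lbracket :: "'g \<Rightarrow> 'g \<Rightarrow> 'g"

text \<open>Cochains are alternating multilinear functions on tuples from the carrier, extended by 0.\<close>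

definition CE_cochains ::
    "('k, 'g, 'z) liealg_scheme \<Rightarrow> ('k \<Rightarrow> 'v \<Rightarrow> 'v) \<Rightarrow> nat \<Rightarrow> ('g list \<Rightarrow> 'v::ab_group_add) set" where
  "CE_cochains \<gg> sV n = {\<phi>.
     (\<forall>xs. xs \<notin> nlists n (vcarrier \<gg>) \<longrightarrow> \<phi> xs = 0) \<and>
     multilinear \<gg> sV n \<phi> \<and>
     (\<forall>xs \<in> nlists n (vcarrier \<gg>). \<not> distinct xs \<longrightarrow> \<phi> xs = 0)}"

definition CE_scale :: "('k \<Rightarrow> 'v \<Rightarrow> 'v) \<Rightarrow> 'k \<Rightarrow> ('g list \<Rightarrow> 'v) \<Rightarrow> 'g list \<Rightarrow> 'v" where
  "CE_scale sV c \<phi> = (\<lambda>xs. sV c (\<phi> xs))"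

definition CE_diff ::
    "('k::field, 'g, 'z) liealg_scheme \<Rightarrow> ('k \<Rightarrow> 'v \<Rightarrow> 'v) \<Rightarrow> ('g \<Rightarrow> 'v \<Rightarrow> 'v) \<Rightarrow> nat
      \<Rightarrow> ('g list \<Rightarrow> 'v::ab_group_add) \<Rightarrow> 'g list \<Rightarrow> 'v" where
  "CE_diff \<gg> sV \<rho> n \<phi> = (\<lambda>xs.
     if xs \<in> nlists (Suc n) (vcarrier \<gg>)
     then (\<Sum>a<Suc n. sV ((-1) ^ a) (\<rho> (xs ! a) (\<phi> (omit a xs)))) +
          (\<Sum>b<Suc n. \<Sum>a<b.
             sV ((-1) ^ (a + b)) (\<phi> (lbracket \<gg> (xs ! a) (xs ! b) # omit a (omit b xs))))
     else 0)"

definition CE_cohomology ::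
    "('k::field, 'g, 'z) liealg_scheme \<Rightarrow> ('k \<Rightarrow> 'v \<Rightarrow> 'v) \<Rightarrow> ('g \<Rightarrow> 'v \<Rightarrow> 'v) \<Rightarrow> nat
      \<Rightarrow> ('k, ('g list \<Rightarrow> 'v::ab_group_add) set) vspace" where
  "CE_cohomology \<gg> sV \<rho> = cohomology (CE_scale sV) (CE_cochains \<gg> sV) (CE_diff \<gg> sV \<rho>)"


section \<open>The quotient Lie algebra and its induced representation\<close>

definition coset_bracket :: "('l \<Rightarrow> 'l \<Rightarrow> 'l) \<Rightarrow> 'l set \<Rightarrow> 'l set \<Rightarrow> 'l set \<Rightarrow> 'l::ab_group_add set" where
  "coset_bracket br H X Y = {br x y | x y. x \<in> X \<and> y \<in> Y} + H"

definition quotient_liealg ::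
    "('k \<Rightarrow> 'l \<Rightarrow> 'l) \<Rightarrow> ('l \<Rightarrow> 'l \<Rightarrow> 'l) \<Rightarrow> 'l set \<Rightarrow> ('k, 'l::ab_group_add set) liealg" where
  "quotient_liealg sL br H =
     vspace.extend (quotient_vspace sL UNIV H) (liealg.fields (coset_bracket br H))"

definition induced_rep :: "('l \<Rightarrow> 'v \<Rightarrow> 'v) \<Rightarrow> 'l set \<Rightarrow> 'v \<Rightarrow> 'v" where
  "induced_rep \<tau> X v = the_elem ((\<lambda>x. \<tau> x v) ` X)"

text \<open>On cosets these are the induced operations. The left Leibniz identity passes to cosets and
  is the Jacobi identity there, since the bracket of cosets is alternating.\<close>

lemma (in isotropic_ideal) coset_eq_iff: "x +o H = y +o H \<longleftrightarrow> x - y \<in> H"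
proof
  assume "x +o H = y +o H"
  moreover have "x \<in> x +o H"
    using subspace_0[OF subspace_H] by (force simp: elt_set_plus_def)
  ultimately show "x - y \<in> H"
    by (auto simp: elt_set_plus_def)
next
  assume d: "x - y \<in> H"
  have "x + h \<in> y +o H" if "h \<in> H" for h
    using subspace_add[OF subspace_H d that]
    by (auto simp: elt_set_plus_def algebra_simps intro!: bexI[of _ "x - y + h"])
  moreover have "y + h \<in> x +o H" if "h \<in> H" for h
    using subspace_diff[OF subspace_H that d]
    by (auto simp: elt_set_plus_def algebra_simps intro!: bexI[of _ "h - (x - y)"])
  ultimately show "x +o H = y +o H"
    by (auto simp: elt_set_plus_def)
qed

lemma (in isotropic_ideal) coset_add: "(x +o H) + (y +o H) = (x + y) +o H"
proof -
  have "H + H = H"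
    using subspace_add[OF subspace_H] subspace_0[OF subspace_H]
    by (force simp: set_plus_def)
  then show ?thesis
    by (simp add: set_plus_rearrange)
qed

lemma (in isotropic_ideal) coset_smult: "coset_smult sL H c (x +o H) = sL c x +o H"
proof -
  have "sL c ` H + H = H"
    using subspace_add[OF subspace_H subspace_scale[OF subspace_H]] subspace_0[OF subspace_H]
    by (force simp: set_plus_def)
  moreover have "sL c ` (x +o H) = sL c x +o sL c ` H"
    by (force simp: elt_set_plus_def scale_right_distrib[symmetric])
  ultimately show ?thesis
    by (simp add: coset_smult_def set_plus_rearrange3)
qed

lemma (in isotropic_ideal) coset_bracket:
  "coset_bracket br H (x +o H) (y +o H) = br x y +o H"
proof -
  have r: "br a (b + c) = br a b + br a c" for a b c
    using module_hom.add[OF Vector_Spaces.linear.axioms(3)[OF br_linear_right]] .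
  have l: "br (a + b) c = br a c + br b c" for a b c
    using module_hom.add[OF Vector_Spaces.linear.axioms(3)[OF br_linear_left]] .
  have mem: "br (x + h) (y + h') + h'' \<in> br x y +o H"
    if "h \<in> H" "h' \<in> H" "h'' \<in> H" for h h' h''
  proof -
    have "br h y + br x h' + br h h' + h'' \<in> H"
      using that by (intro subspace_add[OF subspace_H]) (auto intro: ideal_left ideal_right)
    then show ?thesis
      by (force simp: elt_set_plus_def r l algebra_simps)
  qed
  show ?thesis
  proof
    show "coset_bracket br H (x +o H) (y +o H) \<subseteq> br x y +o H"
      using mem by (auto simp: coset_bracket_def set_plus_def elt_set_plus_def)
    show "br x y +o H \<subseteq> coset_bracket br H (x +o H) (y +o H)"
      using subspace_0[OF subspace_H]
      by (force simp: coset_bracket_def set_plus_def elt_set_plus_def)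
  qed
qed

lemma (in isotropic_ideal) coset_bracket_alternating:
  assumes "left_center br \<subseteq> H"
  shows "coset_bracket br H (x +o H) (x +o H) = H"
proof -
  have "br (br x x) z = 0" for z
    using leibniz[of x x z] by simp
  then have "br x x - 0 \<in> H"
    using assms by (auto simp: left_center_def)
  then show ?thesis
    unfolding coset_bracket coset_eq_iff[symmetric] by (simp add: elt_set_plus_def)
qed

lemma (in H_representation) induced_rep_coset: "induced_rep \<tau> (x +o H) v = \<tau> x v"
proof -
  have "(\<lambda>y. \<tau> y v) ` (x +o H) = {\<tau> x v}"
    using subspace_0[OF subspace_H] by (force simp: elt_set_plus_def tau_add tau_H)
  then show ?thesis
    by (simp add: induced_rep_def)
qed

end

theory Submission
  imports Defs
begin

text \<open>A cochain of \<open>L/H\<close> pulls back to a basic cochain of the \<open>H\<close>-standard complex: one that has only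
  the component \<open>\<omega>\<^sub>0\<close> and vanishes as soon as one argument lies in \<open>H\<close>. This identifies the
  Chevalley-Eilenberg complex with a subcomplex, and it has to be shown that the quotient by it is
  acyclic. Let \<open>P\<close> be a linear projection of \<open>L\<close> onto \<open>H\<close> and \<open>s\<close> the contraction that moves an argument
  \<open>e\<close> to the argument \<open>P e\<close> of the symmetric part. Then \<open>s\<close> kills basic cochains, and with respect
  to a filtration by the number of arguments outside \<open>H\<close> and by \<open>k\<close> the operator \<open>d s + s d\<close> is
  triangular, with the total number of arguments in \<open>H\<close> on the diagonal, as in the Koszul complex.
  That number vanishes only for the basic cochains. All identities for \<open>d\<close>, including \<open>d\<^sup>2 = 0\<close>, follow
  from a Cartan calculus by induction on the number of arguments.\<close>

text \<open>The obstacle is that a projection \<open>P\<close> onto \<open>H\<close> need not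
  commute with the left multiplications, so \<open>d s + s d\<close> is not diagonal. Its
  off-diagonal terms either read a component with one more symmetric argument or replace an argument
  outside \<open>H\<close> by its image in \<open>H\<close>. This dictates the lexicographic order
  of the filtration: fewer arguments outside \<open>H\<close> come before more, and for equal
  numbers a larger \<open>k\<close> before a smaller one. In degree \<open>n\<close>, on
  \<open>k\<close> symmetric arguments and \<open>p\<close> arguments outside \<open>H\<close>, the
  diagonal entry is \<open>k + (n - 2 k - p) = n - p - k\<close>. It has to be inverted, which
  requires characteristic zero; since \<open>p\<close> is at most \<open>n - 2 k\<close>, it
  vanishes only for \<open>k = 0\<close> and \<open>p = n\<close>. Acyclicity is used in a single
  form: a cochain with basic differential is a basic cochain plus a coboundary. For a cocycle this
  gives surjectivity on cohomology, for a cochain that bounds a basic cocycle it gives injectivity,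
  and no quotient complex has to be formed.\<close>

lemma multiplicative_additive_of_nat:
  fixes f :: "'a::field \<Rightarrow> 'b::field_char_0"
  assumes "inj f" and add: "\<And>x y. f (x + y) = f x + f y" and mult: "\<And>x y. f (x * y) = f x * f y"
  shows "f (of_nat n) = of_nat n"
proof -
  have 0: "f 0 = 0" using add[of 0 0] by simp
  then have "f 1 \<noteq> 0" using \<open>inj f\<close> by (metis injD zero_neq_one)
  then have "f 1 = 1" using mult[of 1 1] by simp
  then show ?thesis by (induction n) (simp_all add: 0 add)
qed

text \<open>Transporting \<open>of_nat\<close> along the isomorphism gives characteristic zero,
  which beyond the field axioms is all that the rest uses of the scalars.\<close>

lemma real_or_complex_of_nat_eq_0:
  assumes "of_nat n = (0 :: 'a::real_or_complex)"
  shows "n = 0"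
  using real_or_complex[where 'a='a]
proof (elim disjE exE conjE)
  fix f :: "'a \<Rightarrow> real"
  assume "bij f" "\<forall>x y. f (x + y) = f x + f y \<and> f (x * y) = f x * f y"
  then have "f (of_nat k) = of_nat k" for k
    by (intro multiplicative_additive_of_nat) (auto dest: bij_is_inj)
  from this[of n] this[of 0] show "n = 0" by (simp add: assms)
next
  fix f :: "'a \<Rightarrow> complex"
  assume "bij f" "\<forall>x y. f (x + y) = f x + f y \<and> f (x * y) = f x * f y"
  then have "f (of_nat k) = of_nat k" for k
    by (intro multiplicative_additive_of_nat) (auto dest: bij_is_inj)
  from this[of n] this[of 0] show "n = 0" by (simp add: assms)
qed

section \<open>Lists with an entry omitted or replaced\<close>

lemma omit_simps [simp]: "omit 0 (x # xs) = xs" "omit (Suc i) (x # xs) = x # omit i xs"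
  by (simp_all add: omit_def)

lemma mset_omit: "i < length xs \<Longrightarrow> mset (omit i xs) = mset xs - {#xs ! i#}"
  by (metis Cons_nth_drop_Suc add_mset_remove_trivial append_take_drop_id mset.simps(2)
      mset_append omit_def union_mset_add_mset_right)

lemma mset_update: "j < length hs \<Longrightarrow> mset (hs[j := x]) = mset (x # omit j hs)"
  by (simp add: omit_def upd_conv_take_nth_drop)

lemma length_omit: "i < length xs \<Longrightarrow> length (omit i xs) = length xs - 1"
  by (simp add: omit_def)

lemma omit_map: "omit i (map f xs) = map f (omit i xs)"
  by (simp add: omit_def take_map drop_map)

text \<open>Splitting both lists at \<open>b\<close> shows that they differ only by the entry
  \<open>c\<close>. In \<open>pull_CE_diff\<close> this entry is carried to the front, where the
  Chevalley-Eilenberg differential has the bracket.\<close>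

lemma omit_update:
  assumes "a < b" "b < length xs"
  shows "omit a (xs[b := c]) = omit a (take b xs) @ c # drop (Suc b) xs"
    and "omit a (omit b xs) = omit a (take b xs) @ drop (Suc b) xs"
  using assms by (simp_all add: omit_def upd_conv_take_nth_drop min_def)

text \<open>Passing to multisets makes a sum over the entries of a list visibly symmetric.\<close>

lemma sum_omit_mset_cong:
  fixes F :: "'a \<Rightarrow> 'a list \<Rightarrow> 'b::comm_monoid_add"
  assumes F: "\<And>h xs ys. mset xs = mset ys \<Longrightarrow> F h xs = F h ys" and hs: "mset hs = mset hs'"
  shows "(\<Sum>j<length hs. F (hs ! j) (omit j hs)) = (\<Sum>j<length hs'. F (hs' ! j) (omit j hs'))"
proof -
  define G where "G h M = F h (SOME l. mset l = M)" for h M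
  have G: "F h l = G h (mset l)" for h l
    unfolding G_def by (rule F) (metis (mono_tags, lifting) someI_ex)
  have "(\<Sum>j<length l. F (l ! j) (omit j l)) = (\<Sum>h\<in>#mset l. G h (mset l - {#h#}))" for l
  proof -
    have "(\<Sum>j<length l. F (l ! j) (omit j l)) = (\<Sum>j<length l. G (l ! j) (mset l - {#l ! j#}))"
      by (rule sum.cong) (auto simp: G mset_omit)
    also have "\<dots> = sum_list (map (\<lambda>h. G h (mset l - {#h#})) l)"
      by (simp add: sum_list_sum_nth atLeast0LessThan)
    also have "\<dots> = (\<Sum>h\<in>#mset l. G h (mset l - {#h#}))"
      by (simp flip: sum_mset_sum_list)
    finally show ?thesis .
  qed
  then show ?thesis by (simp add: hs)
qed

text \<open>The shape \<open>a + b = - c\<close> is that of the exchange condition for cochains,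
  which therefore passes to sums and, by the next lemma, to differences.\<close>

lemma skew_add:
  fixes a b c :: "'z::ab_group_add"
  assumes "a + b = - c" and "a' + b' = - c'"
  shows "(a + a') + (b + b') = - (c + c')"
proof -
  have "(a + a') + (b + b') = (a + b) + (a' + b')" by (simp add: ac_simps)
  then show ?thesis by (simp add: assms)
qed

lemma skew_diff:
  fixes a b c :: "'z::ab_group_add"
  assumes "a' + b' = - c'" and "a + b = - c"
  shows "(a - a') + (b - b') = - (c - c')"
proof -
  have "(a - a') + (b - b') = (a + b) - (a' + b')" by (simp add: algebra_simps)
  then show ?thesis by (simp add: assms)
qed

declare nlistsE_length [simp del] nlistsE_set [simp del]

section \<open>Maps between quotient spaces\<close>

lemma elt_set_plus_eq_iff:
  fixes B :: "'c::ab_group_add set"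
  assumes B: "0 \<in> B" "\<And>x y. x \<in> B \<Longrightarrow> y \<in> B \<Longrightarrow> x - y \<in> B"
  shows "a +o B = b +o B \<longleftrightarrow> a - b \<in> B"
proof
  assume "a +o B = b +o B"
  moreover have "a \<in> a +o B" using B(1) by (force simp: elt_set_plus_def)
  ultimately show "a - b \<in> B" by (auto simp: elt_set_plus_def)
next
  assume d: "a - b \<in> B"
  have "a + x \<in> b +o B" if "x \<in> B" for x
    using B(2)[OF d B(2)[OF B(1) that]] by (force simp: elt_set_plus_def algebra_simps)
  moreover have "b + x \<in> a +o B" if "x \<in> B" for x
    using B(2)[OF that d] by (force simp: elt_set_plus_def algebra_simps)
  ultimately show "a +o B = b +o B" by (auto simp: elt_set_plus_def)
qed

lemma elt_set_plus_add:
  fixes B :: "'c::ab_group_add set"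
  assumes B: "0 \<in> B" "\<And>x y. x \<in> B \<Longrightarrow> y \<in> B \<Longrightarrow> x + y \<in> B"
  shows "(a +o B) + (b +o B) = (a + b) +o B"
proof -
  have "B + B = B" using B by (force simp: set_plus_def)
  then show ?thesis by (simp add: set_plus_rearrange)
qed

lemma coset_smult_elt_set_plus:
  fixes B :: "'c::ab_group_add set"
  assumes B: "0 \<in> B" "\<And>x y. x \<in> B \<Longrightarrow> y \<in> B \<Longrightarrow> x + y \<in> B" "\<And>x. x \<in> B \<Longrightarrow> s c x \<in> B"
    and s: "\<And>x y. s c (x + y) = s c x + s c y"
  shows "coset_smult s B c (a +o B) = s c a +o B"
proof -
  have "s c 0 = 0" using s[of 0 0] by simp
  then have "s c ` B + B = B"
    using B by (force simp: set_plus_def)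
  moreover have "s c ` (a +o B) = s c a +o s c ` B"
    by (force simp: elt_set_plus_def s)
  ultimately show ?thesis by (simp add: coset_smult_def set_plus_rearrange3)
qed

text \<open>The isomorphism sends a coset of \<open>B\<close> to its preimage under \<open>T\<close>.\<close>

lemma quotient_vspace_isomorphic:
  fixes s :: "'k \<Rightarrow> 'c \<Rightarrow> 'c::ab_group_add" and t :: "'k \<Rightarrow> 'd \<Rightarrow> 'd::ab_group_add" and T :: "'d \<Rightarrow> 'c"
  assumes B0: "0 \<in> B" and B_diff: "\<And>x y. x \<in> B \<Longrightarrow> y \<in> B \<Longrightarrow> x - y \<in> B"
    and B_smult: "\<And>c x. x \<in> B \<Longrightarrow> s c x \<in> B"
    and A'_add: "\<And>x y. x \<in> A' \<Longrightarrow> y \<in> A' \<Longrightarrow> x + y \<in> A'"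
    and A'_diff: "\<And>x y. x \<in> A' \<Longrightarrow> y \<in> A' \<Longrightarrow> x - y \<in> A'"
    and A'_smult: "\<And>c x. x \<in> A' \<Longrightarrow> t c x \<in> A'" and A'0: "0 \<in> A'"
    and s_add: "\<And>c x y. s c (x + y) = s c x + s c y" and t_add: "\<And>c x y. t c (x + y) = t c x + t c y"
    and T_add: "\<And>x y. T (x + y) = T x + T y" and T_smult: "\<And>c x. T (t c x) = s c (T x)"
    and T_A: "\<And>x. x \<in> A' \<Longrightarrow> T x \<in> A"
    and B': "B' = {x \<in> A'. T x \<in> B}"
    and surj: "\<And>a. a \<in> A \<Longrightarrow> \<exists>x\<in>A'. a - T x \<in> B"
  shows "vspace_isomorphic (quotient_vspace s A B) (quotient_vspace t A' B')"
proof -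
  have B_add: "x + y \<in> B" if "x \<in> B" "y \<in> B" for x y
    using B_diff[OF that(1) B_diff[OF B0 that(2)]] by simp
  have T_diff: "T (x - y) = T x - T y" for x y
    using T_add[of "x - y" y] by simp
  have T0: "T 0 = 0" using T_add[of 0 0] by simp
  have B'0: "0 \<in> B'" using A'0 B0 by (simp add: B' T0)
  have B'_add: "x + y \<in> B'" if "x \<in> B'" "y \<in> B'" for x y
    using that by (simp add: B' A'_add B_add T_add)
  have B'_diff: "x - y \<in> B'" if "x \<in> B'" "y \<in> B'" for x y
    using that by (simp add: B' A'_diff B_diff T_diff)
  have B'_smult: "t c x \<in> B'" if "x \<in> B'" for c x
    using that by (simp add: B' A'_smult B_smult T_smult)
  note coset = elt_set_plus_eq_iff[OF B0 B_diff] elt_set_plus_eq_iff[OF B'0 B'_diff]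
  define \<Phi> where "\<Phi> X = {x \<in> A'. T x \<in> X}" for X
  have \<Phi>: "\<Phi> (T x +o B) = x +o B'" if x: "x \<in> A'" for x
  proof -
    have "y \<in> A' \<and> T y \<in> T x +o B \<longleftrightarrow> y \<in> x +o B'" for y
    proof -
      have "y \<in> x +o B' \<longleftrightarrow> y - x \<in> B'" "T y \<in> T x +o B \<longleftrightarrow> T y - T x \<in> B"
        by (force simp: elt_set_plus_def)+
      moreover have "y \<in> A' \<longleftrightarrow> y - x \<in> A'"
        using A'_add[OF _ x, of "y - x"] A'_diff[OF _ x, of y] by auto
      ultimately show ?thesis by (simp add: B' T_diff)
    qed
    then show ?thesis by (auto simp: \<Phi>_def)
  qed
  \<comment> \<open>By \<open>surj\<close> every class has a representative in the image of
    \<open>T\<close>, so the carrier can be parametrized by \<open>A'\<close>, where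
    \<open>\<Phi>\<close> is known.\<close>
  have carrier: "(\<lambda>a. a +o B) ` A = (\<lambda>x. T x +o B) ` A'"
  proof
    show "(\<lambda>a. a +o B) ` A \<subseteq> (\<lambda>x. T x +o B) ` A'"
      using surj coset(1) by fast
  qed (use T_A in auto)
  have "inj_on \<Phi> ((\<lambda>x. T x +o B) ` A')"
  proof (rule inj_onI, elim imageE)
    fix X Y x y assume "\<Phi> X = \<Phi> Y" and X: "X = T x +o B" "x \<in> A'" and Y: "Y = T y +o B" "y \<in> A'"
    then have "x - y \<in> B'" by (simp add: \<Phi> coset(2))
    then have "T x - T y \<in> B" by (simp add: B' T_diff)
    then show "X = Y" by (simp add: X(1) Y(1) coset(1))
  qed
  moreover have "\<Phi> ` (\<lambda>x. T x +o B) ` A' = (\<lambda>x. x +o B') ` A'"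
    by (auto simp: \<Phi> image_image intro!: image_cong)
  ultimately have "bij_betw \<Phi> ((\<lambda>x. T x +o B) ` A') ((\<lambda>x. x +o B') ` A')"
    by (simp add: bij_betw_def)
  moreover have "\<Phi> ((T x +o B) + (T y +o B)) = \<Phi> (T x +o B) + \<Phi> (T y +o B)" if "x \<in> A'" "y \<in> A'" for x y
    using that \<Phi>[OF A'_add[OF that]]
    by (simp add: \<Phi> elt_set_plus_add[OF B0 B_add] elt_set_plus_add[OF B'0 B'_add] T_add)
  moreover have "\<Phi> (coset_smult s B c (T x +o B)) = coset_smult t B' c (\<Phi> (T x +o B))" if "x \<in> A'" for x c
    using that \<Phi>[OF A'_smult[OF that]]
    by (simp add: \<Phi> coset_smult_elt_set_plus[OF B0 B_add B_smult s_add] T_smult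
       coset_smult_elt_set_plus[OF B'0 B'_add B'_smult t_add])
  ultimately show ?thesis
    unfolding vspace_isomorphic_def quotient_vspace_def vspace.simps carrier by blast
qed

section \<open>Cartan calculus\<close>

locale leibniz_cartan = H_representation sL br H sV \<tau>
  for sL :: "'k::field \<Rightarrow> 'l::ab_group_add \<Rightarrow> 'l" and br :: "'l \<Rightarrow> 'l \<Rightarrow> 'l"
    and H :: "'l set" and sV :: "'k \<Rightarrow> 'v::ab_group_add \<Rightarrow> 'v" and \<tau> :: "'l \<Rightarrow> 'v \<Rightarrow> 'v" +
  assumes left_center_H: "left_center br \<subseteq> H"
    and of_nat_eq_0: "of_nat n = (0 :: 'k) \<Longrightarrow> n = 0"
begin

section \<open>The bracket, the action and the symmetric product\<close>

lemma br_add_right: "br a (b + c) = br a b + br a c"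
  using module_hom.add[OF Vector_Spaces.linear.axioms(3)[OF br_linear_right]] .

lemma br_add_left: "br (a + b) c = br a c + br b c"
  using module_hom.add[OF Vector_Spaces.linear.axioms(3)[OF br_linear_left]] .

lemma br_scale_right: "br a (sL k b) = sL k (br a b)"
  using module_hom.scale[OF Vector_Spaces.linear.axioms(3)[OF br_linear_right]] .

lemma br_scale_left: "br (sL k a) b = sL k (br a b)"
  using module_hom.scale[OF Vector_Spaces.linear.axioms(3)[OF br_linear_left]] .

lemma tau_add_right: "\<tau> e (v + w) = \<tau> e v + \<tau> e w"
  using module_hom.add[OF Vector_Spaces.linear.axioms(3)[OF tau_endo]] .

lemma tau_scale_right: "\<tau> e (sV k v) = sV k (\<tau> e v)"
  using module_hom.scale[OF Vector_Spaces.linear.axioms(3)[OF tau_endo]] .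

lemma tau_zero_right [simp]: "\<tau> e 0 = 0"
  using tau_scale_right[of e 0 0] by simp

text \<open>The Leibniz identity expresses left multiplication by \<open>br a b\<close> as the
  commutator of those by \<open>a\<close> and \<open>b\<close>, which changes sign when
  \<open>a\<close> and \<open>b\<close> are exchanged.\<close>

lemma br_symprod: "br (symprod br a b) c = 0"
  using leibniz[of a b c] leibniz[of b a c] by (simp add: symprod_def br_add_left)

lemma symprod_H: "symprod br a b \<in> H"
  using left_center_H br_symprod by (auto simp: left_center_def)

text \<open>The component index of a cochain is the length of the second list, so it is dropped: below,
  \<open>f es hs\<close> is $\omega_k(e_1,\dots;h_1,\dots,h_k)$ with \<open>k = length hs\<close>, and 0 unless all of \<open>hs\<close> is
  in \<open>H\<close>.\<close>

definition insE :: "'l \<Rightarrow> ('l list \<Rightarrow> 'l list \<Rightarrow> 'v) \<Rightarrow> 'l list \<Rightarrow> 'l list \<Rightarrow> 'v" where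
  "insE e f = (\<lambda>es hs. f (e # es) hs)"

definition insH :: "'l \<Rightarrow> ('l list \<Rightarrow> 'l list \<Rightarrow> 'v) \<Rightarrow> 'l list \<Rightarrow> 'l list \<Rightarrow> 'v" where
  "insH h f = (\<lambda>es hs. f es (h # hs))"

definition scl :: "'k \<Rightarrow> ('l list \<Rightarrow> 'l list \<Rightarrow> 'v) \<Rightarrow> 'l list \<Rightarrow> 'l list \<Rightarrow> 'v" where
  "scl c f = (\<lambda>es hs. sV c (f es hs))"

text \<open>The Lie derivative along \<open>e\<close>. The guard is needed for the support
  condition: \<open>br e\<close> may carry an entry outside \<open>H\<close> into
  \<open>H\<close>.\<close>

definition Lie :: "'l \<Rightarrow> ('l list \<Rightarrow> 'l list \<Rightarrow> 'v) \<Rightarrow> 'l list \<Rightarrow> 'l list \<Rightarrow> 'v" where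
  "Lie e f = (\<lambda>es hs. if set hs \<subseteq> H then
     \<tau> e (f es hs) - (\<Sum>b<length es. f (es[b := br e (es ! b)]) hs)
       - (\<Sum>j<length hs. f es (hs[j := br e (hs ! j)])) else 0)"

text \<open>The map \<open>g\<close> is kept general: a projection onto \<open>H\<close> gives the
  contracting homotopy, and \<open>br h\<close> gives a term of the commutator of \<open>d\<close>
  with the insertion of \<open>h\<close>.\<close>

definition contr :: "('l \<Rightarrow> 'l) \<Rightarrow> ('l list \<Rightarrow> 'l list \<Rightarrow> 'v) \<Rightarrow> 'l list \<Rightarrow> 'l list \<Rightarrow> 'v" where
  "contr g f = (\<lambda>es hs. \<Sum>a<length es. sV ((-1) ^ a) (f (omit a es) (g (es ! a) # hs)))"

text \<open>The differential on cochains without component index: the first two sums are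
  \<open>d_0\<close>, the third is \<open>delta\<close> and the fourth is \<open>d'\<close>. For
  \<open>k = 0\<close> the third sum is empty, in accordance with the convention for
  \<open>delta\<close>.\<close>

definition cobd :: "('l list \<Rightarrow> 'l list \<Rightarrow> 'v) \<Rightarrow> 'l list \<Rightarrow> 'l list \<Rightarrow> 'v" where
  "cobd f = (\<lambda>es hs. if set hs \<subseteq> H then
     (\<Sum>a<length es. sV ((-1) ^ a) (\<tau> (es ! a) (f (omit a es) hs))) +
     (\<Sum>b<length es. \<Sum>a<b. sV ((-1) ^ Suc a) (f (omit a (es[b := br (es ! a) (es ! b)])) hs)) +
     (\<Sum>j<length hs. f (hs ! j # es) (omit j hs)) +
     (\<Sum>a<length es. \<Sum>j<length hs.
        sV ((-1) ^ a) (f (omit a es) (hs[j := br (hs ! j) (es ! a)]))) else 0)"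

text \<open>Linearity is demanded in the first entry only; the symmetry conditions give the others.\<close>

definition precochain :: "('l list \<Rightarrow> 'l list \<Rightarrow> 'v) \<Rightarrow> bool" where
  "precochain f \<longleftrightarrow>
     (\<forall>es hs. \<not> set hs \<subseteq> H \<longrightarrow> f es hs = 0) \<and>
     (\<forall>a b. insE (a + b) f = insE a f + insE b f) \<and>
     (\<forall>c a. insE (sL c a) f = scl c (insE a f)) \<and>
     (\<forall>a\<in>H. \<forall>b\<in>H. insH (a + b) f = insH a f + insH b f) \<and>
     (\<forall>c. \<forall>a\<in>H. insH (sL c a) f = scl c (insH a f)) \<and>
     (\<forall>es hs hs'. mset hs = mset hs' \<longrightarrow> f es hs = f es hs') \<and>
     (\<forall>xs a b ys hs. f (xs @ a # b # ys) hs + f (xs @ b # a # ys) hs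
        = - f (xs @ ys) (symprod br a b # hs))"

lemma precochainI:
  assumes "\<And>es hs. \<not> set hs \<subseteq> H \<Longrightarrow> f es hs = 0"
    and "\<And>a b. insE (a + b) f = insE a f + insE b f"
    and "\<And>c a. insE (sL c a) f = scl c (insE a f)"
    and "\<And>a b. a \<in> H \<Longrightarrow> b \<in> H \<Longrightarrow> insH (a + b) f = insH a f + insH b f"
    and "\<And>c a. a \<in> H \<Longrightarrow> insH (sL c a) f = scl c (insH a f)"
    and "\<And>es hs hs'. mset hs = mset hs' \<Longrightarrow> f es hs = f es hs'"
    and "\<And>xs a b ys hs. f (xs @ a # b # ys) hs + f (xs @ b # a # ys) hs
        = - f (xs @ ys) (symprod br a b # hs)"
  shows "precochain f"
  using assms unfolding precochain_def by blast

lemma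
  assumes "precochain f"
  shows pre_supp: "\<not> set hs \<subseteq> H \<Longrightarrow> f es hs = 0"
    and pre_addE: "insE (a + b) f = insE a f + insE b f"
    and pre_scaleE: "insE (sL c a) f = scl c (insE a f)"
    and pre_addH: "a \<in> H \<Longrightarrow> b \<in> H \<Longrightarrow> insH (a + b) f = insH a f + insH b f"
    and pre_scaleH: "a \<in> H \<Longrightarrow> insH (sL c a) f = scl c (insH a f)"
    and pre_sym: "mset hs = mset hs' \<Longrightarrow> f es hs = f es hs'"
    and pre_skew: "f (xs @ a # b # ys) hs + f (xs @ b # a # ys) hs
        = - f (xs @ ys) (symprod br a b # hs)"
  using assms unfolding precochain_def by blast+

section \<open>Linearity of the operators, closure of precochains under insertions\<close>

lemma scl_add: "scl c (f + g) = scl c f + scl c g"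
  and scl_diff: "scl c (f - g) = scl c f - scl c g"
  and scl_zero: "scl c 0 = 0"
  and scl_zero_left: "scl 0 f = 0"
  and scl_scl: "scl c (scl k f) = scl (c * k) f"
  and scl_neg_one: "scl (-1) f = - f"
  by (auto simp: scl_def fun_eq_iff V.scale_right_distrib V.scale_right_diff_distrib)

lemma insE_add [simp]: "insE e (f + g) = insE e f + insE e g"
  and insE_scl [simp]: "insE e (scl c f) = scl c (insE e f)"
  and insE_minus [simp]: "insE e (- f) = - insE e f"
  and insE_diff [simp]: "insE e (f - g) = insE e f - insE e g"
  and insH_add [simp]: "insH e (f + g) = insH e f + insH e g"
  and insH_scl [simp]: "insH e (scl c f) = scl c (insH e f)"
  and insH_minus [simp]: "insH e (- f) = - insH e f"
  and insH_diff [simp]: "insH e (f - g) = insH e f - insH e g"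
  and insH_insE: "insH h (insE e f) = insE e (insH h f)"
  by (auto simp: insE_def insH_def scl_def fun_eq_iff)

lemma Lie_add: "Lie e (f + g) = Lie e f + Lie e g"
  by (auto simp: Lie_def fun_eq_iff tau_add_right sum.distrib)

lemma contr_add: "contr u (f + g) = contr u f + contr u g"
  by (auto simp: contr_def fun_eq_iff V.scale_right_distrib sum.distrib)

lemma cobd_add: "cobd (f + g) = cobd f + cobd g"
  by (auto simp: cobd_def fun_eq_iff V.scale_right_distrib tau_add_right sum.distrib simp del: power_Suc)

lemma Lie_scl: "Lie e (scl c f) = scl c (Lie e f)"
  by (auto simp: Lie_def scl_def fun_eq_iff tau_scale_right V.scale_sum_right
      V.scale_right_diff_distrib)

lemma contr_scl: "contr u (scl c f) = scl c (contr u f)"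
  by (auto simp: contr_def scl_def fun_eq_iff V.scale_sum_right mult.commute)

lemma cobd_scl: "cobd (scl c f) = scl c (cobd f)"
  by (auto simp: cobd_def scl_def fun_eq_iff V.scale_sum_right tau_scale_right
      V.scale_right_distrib simp del: V.scale_scale power_Suc
      intro!: arg_cong2[where f="(+)"] sum.cong V.scale_left_commute)

lemma Lie_minus: "Lie e (- f) = - Lie e f"
  and contr_minus: "contr u (- f) = - contr u f"
  and cobd_minus: "cobd (- f) = - cobd f"
  using Lie_scl[of e "-1" f] contr_scl[of u "-1" f] cobd_scl[of "-1" f] by (simp_all add: scl_neg_one)

lemma Lie_diff: "Lie e (f - g) = Lie e f - Lie e g"
  using Lie_add[of e f "- g"] by (simp add: Lie_minus)

lemma contr_diff: "contr u (f - g) = contr u f - contr u g"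
  using contr_add[of u f "- g"] by (simp add: contr_minus)

lemma cobd_diff: "cobd (f - g) = cobd f - cobd g"
  using cobd_add[of f "- g"] by (simp add: cobd_minus)

lemmas op_linear = Lie_add contr_add cobd_add Lie_scl contr_scl cobd_scl Lie_minus contr_minus
  cobd_minus Lie_diff contr_diff cobd_diff

lemma precochain_zero [intro]: "precochain 0"
  by (simp add: precochain_def insE_def insH_def scl_def fun_eq_iff)

lemma precochain_add [intro]:
  assumes f: "precochain f" and g: "precochain g" shows "precochain (f + g)"
proof (rule precochainI)
  show "(f + g) (xs @ a # b # ys) hs + (f + g) (xs @ b # a # ys) hs
      = - (f + g) (xs @ ys) (symprod br a b # hs)" for xs a b ys hs
    using pre_skew[OF f, of xs a b ys hs] pre_skew[OF g, of xs a b ys hs]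
    by (simp add: algebra_simps)
  show "(f + g) es hs = (f + g) es hs'" if "mset hs = mset hs'" for es hs hs'
    using pre_sym[OF f that] pre_sym[OF g that] by simp
qed (simp_all add: pre_supp[OF f] pre_supp[OF g] pre_addE[OF f] pre_addE[OF g] pre_addH[OF f]
    pre_addH[OF g] pre_scaleE[OF f] pre_scaleE[OF g] pre_scaleH[OF f] pre_scaleH[OF g] scl_add)

lemma precochain_scl [intro]: assumes f: "precochain f" shows "precochain (scl c f)"
proof (rule precochainI)
  show "scl c f (xs @ a # b # ys) hs + scl c f (xs @ b # a # ys) hs
      = - scl c f (xs @ ys) (symprod br a b # hs)" for xs a b ys hs
    using arg_cong[OF pre_skew[OF f, of xs a b ys hs], of "sV c"]
    by (simp add: scl_def V.scale_right_distrib)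
  show "scl c f es hs = scl c f es hs'" if "mset hs = mset hs'" for es hs hs'
    using pre_sym[OF f that] by (simp add: scl_def)
  show "\<not> set hs \<subseteq> H \<Longrightarrow> scl c f es hs = 0" for es hs
    using pre_supp[OF f] by (simp add: scl_def)
qed (simp_all add: pre_addE[OF f] pre_addH[OF f] pre_scaleE[OF f] pre_scaleH[OF f]
    scl_add scl_scl mult.commute)

lemma precochain_minus [intro]: "precochain f \<Longrightarrow> precochain (- f)"
  using precochain_scl[of f "-1"] by (simp add: scl_neg_one)

lemma precochain_diff [intro]: "precochain f \<Longrightarrow> precochain g \<Longrightarrow> precochain (f - g)"
  using precochain_add[OF _ precochain_minus, of f g] by simp

text \<open>The first entry of \<open>insE e f\<close> is the second entry of \<open>f\<close>.
  Exchanging it with \<open>e\<close> brings it to the front, where linearity is known, at the cost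
  of a term in \<open>symprod br e x\<close>, which is linear in \<open>x\<close> and lies in
  \<open>H\<close>. In this way linearity spreads from the first entry to all others.\<close>

lemma precochain_insE [intro]: assumes f: "precochain f" shows "precochain (insE e f)"
proof -
  have split: "f (e # x # es) hs = - f (x # e # es) hs - f es (symprod br e x # hs)" for x es hs
    using pre_skew[OF f, of "[]" e x es hs] by (simp add: algebra_simps) (metis add.commute eq_neg_iff_add_eq_0 add.assoc minus_add_cancel)
  have sym: "symprod br e (a + b) = symprod br e a + symprod br e b"
    "symprod br e (sL c a) = sL c (symprod br e a)" for a b c
    by (simp_all add: symprod_def br_add_left br_add_right br_scale_left br_scale_right
        scale_right_distrib)
  have A: "insE (a + b) (insE e f) = insE a (insE e f) + insE b (insE e f)" for a b
    using pre_addE[OF f, of a b] pre_addH[OF f symprod_H symprod_H, of e a e b]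
    by (simp add: insE_def insH_def fun_eq_iff split sym)
  have B: "insE (sL c a) (insE e f) = scl c (insE a (insE e f))" for a c
    using pre_scaleE[OF f, of c a] pre_scaleH[OF f symprod_H, of c e a]
    by (simp add: insE_def insH_def scl_def fun_eq_iff split sym V.scale_right_diff_distrib)
  have D: "insE e f (xs @ a # b # ys) hs + insE e f (xs @ b # a # ys) hs
      = - insE e f (xs @ ys) (symprod br a b # hs)" for xs a b ys hs
    using pre_skew[OF f, of "e # xs" a b ys hs] by (simp add: insE_def)
  show ?thesis
  proof (rule precochainI)
    show "insE e f es hs = insE e f es hs'" if "mset hs = mset hs'" for es hs hs'
      using pre_sym[OF f that] by (simp add: insE_def)
    show "insE e f es hs = 0" if "\<not> set hs \<subseteq> H" for es hs
      using pre_supp[OF f that] by (simp add: insE_def)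
  qed (simp_all only: A B D insH_insE pre_addH[OF f] pre_scaleH[OF f] insE_add insE_scl)
qed

lemma insH_commute: assumes f: "precochain f" shows "insH a (insH b f) = insH b (insH a f)"
  by (auto simp: insH_def fun_eq_iff intro: pre_sym[OF f])

lemma precochain_insH [intro]:
  assumes f: "precochain f" and h: "h \<in> H" shows "precochain (insH h f)"
proof -
  have D: "insH h f (xs @ a # b # ys) hs + insH h f (xs @ b # a # ys) hs
      = - insH h f (xs @ ys) (symprod br a b # hs)" for xs a b ys hs
    using pre_skew[OF f, of xs a b ys "h # hs"]
      pre_sym[OF f, of "symprod br a b # h # hs" "h # symprod br a b # hs"] by (simp add: insH_def)
  have *: "insE a (insH h f) = insH h (insE a f)" for a by (simp add: insH_insE)
  show ?thesis
  proof (rule precochainI)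
    show "insH h f es hs = insH h f es hs'" if "mset hs = mset hs'" for es hs hs'
      using pre_sym[OF f, of "h # hs" "h # hs'"] that by (simp add: insH_def)
    show "insH h f es hs = 0" if "\<not> set hs \<subseteq> H" for es hs
      using pre_supp[OF f, of "h # hs"] that by (simp add: insH_def)
  qed (simp_all only: * D pre_addE[OF f] pre_scaleE[OF f] insH_commute[OF f, of _ h]
        pre_addH[OF f] pre_scaleH[OF f] insH_add insH_scl)
qed

lemma insE_insE: assumes f: "precochain f"
  shows "insE a (insE b f) + insE b (insE a f) = - insH (symprod br a b) f"
  using pre_skew[OF f, of "[]" b a] pre_skew[OF f, of "[]" a b]
  by (simp add: insE_def insH_def fun_eq_iff add.commute)


section \<open>Commutators of the operators with insertions\<close>

lemma insE_Lie:
  assumes f: "precochain f"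
  shows "insE x (Lie e f) = Lie e (insE x f) - insE (br e x) f"
  by (auto simp: insE_def Lie_def fun_eq_iff pre_supp[OF f] sum.lessThan_Suc_shift algebra_simps
      simp del: sum.lessThan_Suc)

lemma insH_Lie:
  assumes f: "precochain f" and h: "h \<in> H"
  shows "insH h (Lie e f) = Lie e (insH h f) - insH (br e h) f"
  using h by (auto simp: insH_def Lie_def fun_eq_iff pre_supp[OF f] sum.lessThan_Suc_shift
      algebra_simps simp del: sum.lessThan_Suc)

lemma insE_contr: "insE x (contr g f) = insH (g x) f - contr g (insE x f)"
  by (simp add: insE_def insH_def contr_def fun_eq_iff sum.lessThan_Suc_shift sum_negf
      del: sum.lessThan_Suc)

lemma insH_contr: assumes f: "precochain f" shows "insH h (contr g f) = contr g (insH h f)"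
  by (auto simp: insH_def contr_def fun_eq_iff intro!: sum.cong arg_cong[where f="sV _"] pre_sym[OF f])

text \<open>Both extra terms are summands for the front symmetric argument \<open>h\<close>:
  \<open>delta\<close> moves it to the first list, and \<open>d'\<close> brackets it with each entry
  in turn.\<close>

lemma insH_cobd:
  assumes f: "precochain f" and h: "h \<in> H"
  shows "insH h (cobd f) = cobd (insH h f) + insE h f + contr (br h) f"
proof -
  have "contr (br h) f es hs = 0" "f (h # es) hs = 0" if "\<not> set hs \<subseteq> H" for es hs
    using that by (auto simp: contr_def pre_supp[OF f])
  then show ?thesis using h
    by (auto simp: insE_def insH_def cobd_def contr_def fun_eq_iff sum.lessThan_Suc_shift
      algebra_simps sum.distrib simp del: sum.lessThan_Suc power_Suc)
qed

text \<open>Cartan's formula. The summands that involve the front entry \<open>e\<close> assemble to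
  the Lie derivative; those that leave it in place form the differential of \<open>insE e f\<close>
  with opposite sign.\<close>

lemma insE_cobd:
  assumes f: "precochain f"
  shows "insE e (cobd f) = Lie e f - cobd (insE e f)"
proof (intro ext)
  fix es hs
  show "insE e (cobd f) es hs = (Lie e f - cobd (insE e f)) es hs"
  proof (cases "set hs \<subseteq> H")
    case True
    have 1: "(\<Sum>a<Suc (length es). sV ((-1) ^ a) (\<tau> ((e # es) ! a) (f (omit a (e # es)) hs)))
      = \<tau> e (f es hs) - (\<Sum>a<length es. sV ((-1) ^ a) (\<tau> (es ! a) (f (e # omit a es) hs)))"
      by (simp add: sum.lessThan_Suc_shift sum_negf del: sum.lessThan_Suc)
    have 2: "(\<Sum>b<Suc (length es). \<Sum>a<b. sV ((-1) ^ Suc a)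
          (f (omit a ((e # es)[b := br ((e # es) ! a) ((e # es) ! b)])) hs))
      = - (\<Sum>b<length es. f (es[b := br e (es ! b)]) hs)
        - (\<Sum>b<length es. \<Sum>a<b. sV ((-1) ^ Suc a)
          (f (e # omit a (es[b := br (es ! a) (es ! b)])) hs))"
      by (simp add: sum.lessThan_Suc_shift sum_negf sum_subtractf del: sum.lessThan_Suc)
    \<comment> \<open>In \<open>delta\<close> the entry \<open>h\<close> lands in front of
      \<open>e\<close> and has to be exchanged with it. Of the two brackets that appear,
      \<open>br h e\<close> cancels the first sum in \<open>4\<close> below, and
      \<open>br e h\<close> is the one in the Lie derivative.\<close>
    have 3: "f (h # e # es) (omit j hs) = - f (e # h # es) (omit j hs)
        - f es (hs[j := br h e]) - f es (hs[j := br e h])" if "h = hs ! j" "j < length hs" for h j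
    proof -
      have h: "h \<in> H" using that True by auto
      have "f (h # e # es) (omit j hs) + f (e # h # es) (omit j hs)
          = - f es ((br h e + br e h) # omit j hs)"
        using pre_skew[OF f, of "[]" h e es "omit j hs"] by (simp add: symprod_def)
      also have "f es ((br h e + br e h) # omit j hs)
          = f es (br h e # omit j hs) + f es (br e h # omit j hs)"
        using fun_cong[OF fun_cong[OF pre_addH[OF f ideal_left[OF h] ideal_right[OF h]]]]
        by (simp add: insH_def)
      finally show ?thesis
        using that pre_sym[OF f, of "hs[j := x]" "x # omit j hs" es for x]
        by (simp add: mset_update eq_neg_iff_add_eq_0 eq_diff_eq diff_eq_eq ac_simps)
    qed
    have 4: "(\<Sum>a<Suc (length es). \<Sum>j<length hs. sV ((-1) ^ a)
          (f (omit a (e # es)) (hs[j := br (hs ! j) ((e # es) ! a)])))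
      = (\<Sum>j<length hs. f es (hs[j := br (hs ! j) e])) - (\<Sum>a<length es. \<Sum>j<length hs.
          sV ((-1) ^ a) (f (e # omit a es) (hs[j := br (hs ! j) (es ! a)])))"
      by (simp add: sum.lessThan_Suc_shift sum_negf del: sum.lessThan_Suc)
    show ?thesis
      unfolding insE_def cobd_def Lie_def minus_apply if_P[OF True] list.size(4) add_Suc_right add_0_right
        One_nat_def 1 2 4
      by (simp add: 3 sum_subtractf sum_negf sum.distrib)
  qed (simp add: insE_def Lie_def cobd_def)
qed

text \<open>The relations between an operator and the insertions reduce every identity between operators
  to the trivial case of no arguments.\<close>

lemma operator_eqI:
  assumes supp: "\<And>f es hs. precochain f \<Longrightarrow> \<not> set hs \<subseteq> H \<Longrightarrow> R f es hs = 0"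
    and base: "\<And>f. precochain f \<Longrightarrow> R f [] [] = 0"
    and E: "\<And>f e. precochain f \<Longrightarrow> insE e (R f) = R (insE e f) \<or> insE e (R f) = - R (insE e f)"
    and H: "\<And>f h. precochain f \<Longrightarrow> h \<in> H \<Longrightarrow> insH h (R f) = R (insH h f)"
    and f: "precochain f"
  shows "R f = 0"
proof -
  have "R f es hs = 0" for es hs
    using f
  proof (induction es arbitrary: f hs)
    case Nil
    then show ?case
    proof (induction hs arbitrary: f)
      case (Cons h hs)
      show ?case
      proof (cases "h \<in> H")
        case True
        then have "R f [] (h # hs) = R (insH h f) [] hs"
          using fun_cong[OF fun_cong[OF H[OF Cons.prems]]] by (simp add: insH_def)
        then show ?thesis using Cons.IH Cons.prems True by auto
      qed (simp add: supp Cons.prems)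
    qed (simp add: base)
  next
    case (Cons e es)
    have "R f (e # es) hs = insE e (R f) es hs" by (simp add: insE_def)
    also have "\<dots> = 0"
      using E[OF Cons.prems, of e] Cons.IH[OF precochain_insE[OF Cons.prems], of e hs] by auto
    finally show ?case .
  qed
  then show ?thesis by (simp add: fun_eq_iff)
qed

text \<open>Inserting \<open>x\<close> turns \<open>A f\<close> into \<open>A (insE x f)\<close>, up
  to sign and up to another precochain. By induction on the entries before the exchanged pair, the
  exchange condition therefore has to be checked only at the front. The sign is plus for the even
  operator \<open>Lie\<close> and minus for the odd ones \<open>contr\<close> and
  \<open>cobd\<close>.\<close>

lemma precochain_operatorI:
  assumes supp: "\<And>f es hs. precochain f \<Longrightarrow> \<not> set hs \<subseteq> H \<Longrightarrow> A f es hs = 0"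
    and "\<And>a b f. precochain f \<Longrightarrow> insE (a + b) (A f) = insE a (A f) + insE b (A f)"
    and "\<And>c a f. precochain f \<Longrightarrow> insE (sL c a) (A f) = scl c (insE a (A f))"
    and "\<And>a b f. precochain f \<Longrightarrow> a \<in> H \<Longrightarrow> b \<in> H \<Longrightarrow> insH (a + b) (A f) = insH a (A f) + insH b (A f)"
    and "\<And>c a f. precochain f \<Longrightarrow> a \<in> H \<Longrightarrow> insH (sL c a) (A f) = scl c (insH a (A f))"
    and "\<And>es hs hs' f. precochain f \<Longrightarrow> mset hs = mset hs' \<Longrightarrow> A f es hs = A f es hs'"
    and first: "\<And>a b f. precochain f \<Longrightarrow>
      insE a (insE b (A f)) + insE b (insE a (A f)) = - insH (symprod br a b) (A f)"
    and step: "\<And>f x. precochain f \<Longrightarrow>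
      \<exists>g. precochain g \<and> (insE x (A f) = A (insE x f) + g \<or> insE x (A f) = g - A (insE x f))"
    and f: "precochain f"
  shows "precochain (A f)"
proof (rule precochainI)
  have skew: "A f (xs @ a # b # ys) hs + A f (xs @ b # a # ys) hs
        = - A f (xs @ ys) (symprod br a b # hs)" for xs a b ys hs
    using f
  proof (induction xs arbitrary: f)
    case Nil
    then show ?case
      using fun_cong[OF fun_cong[OF first[OF Nil, of b a], of ys], of hs]
      by (simp add: insE_def insH_def symprod_def add.commute)
  next
    case (Cons x xs)
    have *: "A f (x # zs) hs = insE x (A f) zs hs" for zs hs by (simp add: insE_def)
    obtain g where g: "precochain g"
      "insE x (A f) = A (insE x f) + g \<or> insE x (A f) = g - A (insE x f)"
      using step[OF Cons.prems] by blast
    then show ?case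
      using Cons.IH[OF precochain_insE[OF Cons.prems], of x] pre_skew[OF g(1), of xs a b ys hs]
      by (auto simp: * skew_add skew_diff)
  qed
  show "A f (xs @ a # b # ys) hs + A f (xs @ b # a # ys) hs
        = - A f (xs @ ys) (symprod br a b # hs)" for xs a b ys hs by (rule skew)
qed (erule assms(1)[OF f], rule assms(2)[OF f], rule assms(3)[OF f], erule (1) assms(4)[OF f],
    erule assms(5)[OF f], erule assms(6)[OF f])


text \<open>An insertion lowers the position by one and yields a precochain again, so the first
  entry suffices.\<close>

lemma
  assumes f: "precochain f" and i: "i < length es"
  shows pre_add_nth: "f (es[i := x + y]) hs = f (es[i := x]) hs + f (es[i := y]) hs"
    and pre_scale_nth: "f (es[i := sL c x]) hs = sV c (f (es[i := x]) hs)"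
proof -
  have "f (es[i := x + y]) hs = f (es[i := x]) hs + f (es[i := y]) hs \<and>
    f (es[i := sL c x]) hs = sV c (f (es[i := x]) hs)"
    using f i
  proof (induction es arbitrary: f i)
    case (Cons e es)
    show ?case
    proof (cases i)
      case 0
      then show ?thesis
        using fun_cong[OF fun_cong[OF pre_addE[OF Cons.prems(1)]]]
          fun_cong[OF fun_cong[OF pre_scaleE[OF Cons.prems(1)]]]
        by (simp add: insE_def scl_def)
    next
      case (Suc j)
      then show ?thesis
        using Cons.IH[OF precochain_insE[OF Cons.prems(1), of e], of j] Cons.prems(2)
        by (simp add: insE_def)
    qed
  qed simp
  then show "f (es[i := x + y]) hs = f (es[i := x]) hs + f (es[i := y]) hs"
    "f (es[i := sL c x]) hs = sV c (f (es[i := x]) hs)" by simp_all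
qed

lemma pre_sym_Cons: "precochain f \<Longrightarrow> mset hs = mset hs' \<Longrightarrow> f es (h # hs) = f es (h # hs')"
  by (rule pre_sym) simp_all

lemma pre_update: "precochain f \<Longrightarrow> j < length hs \<Longrightarrow> f es (hs[j := x]) = f es (x # omit j hs)"
  by (rule pre_sym) (simp_all add: mset_update)

lemma
  assumes f: "precochain f" and i: "i < length hs" and x: "x \<in> H"
  shows pre_addH_nth: "y \<in> H \<Longrightarrow> f es (hs[i := x + y]) = f es (hs[i := x]) + f es (hs[i := y])"
    and pre_scaleH_nth: "f es (hs[i := sL c x]) = sV c (f es (hs[i := x]))"
  using fun_cong[OF fun_cong[OF pre_addH[OF f x]]] fun_cong[OF fun_cong[OF pre_scaleH[OF f x]]]
  by (simp_all add: insH_def scl_def pre_update[OF f i])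

lemma precochain_Lie [intro]: assumes f: "precochain f" shows "precochain (Lie e f)"
proof (rule precochain_operatorI[where A="Lie e", OF _ _ _ _ _ _ _ _ f])
  fix f assume f: "precochain f"
  show "Lie e f es hs = 0" if "\<not> set hs \<subseteq> H" for es hs
    using that by (simp add: Lie_def)
  show "insE (a + b) (Lie e f) = insE a (Lie e f) + insE b (Lie e f)" for a b
    by (simp add: insE_Lie[OF f] pre_addE[OF f] br_add_right Lie_add)
  show "insE (sL c a) (Lie e f) = scl c (insE a (Lie e f))" for c a
    by (simp add: insE_Lie[OF f] pre_scaleE[OF f] br_scale_right Lie_scl scl_diff)
  show "insH (a + b) (Lie e f) = insH a (Lie e f) + insH b (Lie e f)" if "a \<in> H" "b \<in> H" for a b
    using that by (simp add: insH_Lie[OF f] pre_addH[OF f] br_add_right Lie_add ideal_right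
        subspace_add[OF subspace_H])
  show "insH (sL c a) (Lie e f) = scl c (insH a (Lie e f))" if "a \<in> H" for c a
    using that by (simp add: insH_Lie[OF f] pre_scaleH[OF f] br_scale_right Lie_scl scl_diff
        ideal_right subspace_scale[OF subspace_H])
  show "Lie e f es hs = Lie e f es hs'" if m: "mset hs = mset hs'" for es hs hs'
  proof -
    have "(\<Sum>j<length hs. f es (hs[j := br e (hs ! j)]))
        = (\<Sum>j<length hs'. f es (hs'[j := br e (hs' ! j)]))"
      using sum_omit_mset_cong[of "\<lambda>h l. f es (br e h # l)", OF pre_sym_Cons[OF f] m]
      by (simp add: pre_update[OF f])
    then show ?thesis
      using mset_eq_setD[OF m] pre_sym[OF f m] unfolding Lie_def by presburger
  qed
  show "insE a (insE b (Lie e f)) + insE b (insE a (Lie e f)) = - insH (symprod br a b) (Lie e f)" for a b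
  proof -
    have 1: "insE a (insE b (Lie e f)) = Lie e (insE a (insE b f)) - insE (br e a) (insE b f)
        - insE a (insE (br e b) f)" for a b
      by (simp add: insE_Lie f precochain_insE)
    have 2: "br e (symprod br a b) = symprod br (br e a) b + symprod br a (br e b)"
      using leibniz[of e a b] leibniz[of e b a] by (simp add: symprod_def br_add_right)
    \<comment> \<open>Grouping the terms into anticommutators of insertions makes
      \<open>insE_insE\<close> applicable to each; the derivation property \<open>2\<close> then
      reassembles them.\<close>
    have "insE a (insE b (Lie e f)) + insE b (insE a (Lie e f))
        = Lie e (insE a (insE b f) + insE b (insE a f))
          - (insE (br e a) (insE b f) + insE b (insE (br e a) f))
          - (insE a (insE (br e b) f) + insE (br e b) (insE a f))"
      unfolding 1 Lie_add by (simp add: algebra_simps)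
    also have "\<dots> = - insH (symprod br a b) (Lie e f)"
      unfolding insE_insE[OF f] Lie_minus insH_Lie[OF f symprod_H] 2 pre_addH[OF f symprod_H symprod_H]
      by simp
    finally show ?thesis .
  qed
  show "\<exists>g. precochain g \<and> (insE x (Lie e f) = Lie e (insE x f) + g \<or>
      insE x (Lie e f) = g - Lie e (insE x f))" for x
    by (rule exI[of _ "- insE (br e x) f"]) (simp add: insE_Lie[OF f] f precochain_minus precochain_insE)
qed

definition linear_into_H :: "('l \<Rightarrow> 'l) \<Rightarrow> bool" where
  "linear_into_H g \<longleftrightarrow> (\<forall>a b. g (a + b) = g a + g b) \<and> (\<forall>c a. g (sL c a) = sL c (g a)) \<and> (\<forall>a. g a \<in> H)"

lemma
  assumes "linear_into_H g"
  shows linH_add: "g (a + b) = g a + g b"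
    and linH_scale: "g (sL c a) = sL c (g a)"
    and linH_mem: "g a \<in> H"
  using assms by (auto simp: linear_into_H_def)

lemma linear_into_H_br: "h \<in> H \<Longrightarrow> linear_into_H (br h)"
  by (simp add: linear_into_H_def br_add_right br_scale_right ideal_left)

text \<open>This map is the derivative of \<open>g\<close> along \<open>e\<close>. It measures how
  far \<open>g\<close> is from commuting with left multiplication, and is the source of off-diagonal
  terms of the Laplacian.\<close>

lemma linear_into_H_commutator:
  "linear_into_H g \<Longrightarrow> linear_into_H (\<lambda>x. br e (g x) - g (br e x))"
  by (simp add: linear_into_H_def br_add_right br_scale_right ideal_right scale_right_diff_distrib
      subspace_diff[OF subspace_H])

lemma precochain_contr [intro]:
  assumes g: "linear_into_H g" and f: "precochain f" shows "precochain (contr g f)"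
proof (rule precochain_operatorI[where A="contr g", OF _ _ _ _ _ _ _ _ f])
  note g' = linH_add[OF g] linH_scale[OF g] linH_mem[OF g]
  fix f assume f: "precochain f"
  show "contr g f es hs = 0" if "\<not> set hs \<subseteq> H" for es hs
    using that by (simp add: contr_def pre_supp[OF f])
  show "insE (a + b) (contr g f) = insE a (contr g f) + insE b (contr g f)" for a b
    by (simp add: insE_contr pre_addE[OF f] pre_addH[OF f] g' contr_add)
  show "insE (sL c a) (contr g f) = scl c (insE a (contr g f))" for c a
    by (simp add: insE_contr pre_scaleE[OF f] pre_scaleH[OF f] g' contr_scl scl_diff)
  show "insH (a + b) (contr g f) = insH a (contr g f) + insH b (contr g f)" if "a \<in> H" "b \<in> H" for a b
    using that by (simp add: insH_contr[OF f] pre_addH[OF f] contr_add)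
  show "insH (sL c a) (contr g f) = scl c (insH a (contr g f))" if "a \<in> H" for c a
    using that by (simp add: insH_contr[OF f] pre_scaleH[OF f] contr_scl)
  show "contr g f es hs = contr g f es hs'" if m: "mset hs = mset hs'" for es hs hs'
    unfolding contr_def by (intro sum.cong arg_cong[where f="sV _"] pre_sym[OF f]) (auto simp: m)
  show "insE a (insE b (contr g f)) + insE b (insE a (contr g f)) = - insH (symprod br a b) (contr g f)" for a b
  proof -
    \<comment> \<open>The two terms with \<open>insH\<close> form an expression that is
      antisymmetric in \<open>a\<close> and \<open>b\<close>, so they disappear from the
      anticommutator.\<close>
    have 1: "insE a (insE b (contr g f)) = insE a (insH (g b) f) - insE b (insH (g a) f)
        + contr g (insE a (insE b f))" for a b
      by (simp add: insE_contr insH_insE)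
    have "insE a (insE b (contr g f)) + insE b (insE a (contr g f))
        = contr g (insE a (insE b f) + insE b (insE a f))"
      unfolding 1 contr_add by (simp add: algebra_simps)
    then show ?thesis
      unfolding insE_insE[OF f] contr_minus insH_contr[OF f] .
  qed
  show "\<exists>ga. precochain ga \<and> (insE x (contr g f) = contr g (insE x f) + ga \<or>
      insE x (contr g f) = ga - contr g (insE x f))" for x
    by (rule exI[of _ "insH (g x) f"]) (auto simp: insE_contr f g')
qed

lemma contr_plus_fun:
  assumes f: "precochain f" and "\<And>x. g x \<in> H" "\<And>x. g' x \<in> H"
  shows "contr (\<lambda>x. g x + g' x) f = contr g f + contr g' f"
proof -
  have "f es ((g x + g' x) # hs) = f es (g x # hs) + f es (g' x # hs)" for es hs x
    using fun_cong[OF fun_cong[OF pre_addH[OF f assms(2,3)]]] by (simp add: insH_def)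
  then show ?thesis
    by (simp add: contr_def fun_eq_iff V.scale_right_distrib sum.distrib)
qed

lemma contr_scale_fun:
  assumes f: "precochain f" and "\<And>x. g x \<in> H"
  shows "contr (\<lambda>x. sL c (g x)) f = scl c (contr g f)"
proof -
  have "f es (sL c (g x) # hs) = sV c (f es (g x # hs))" for es hs x
    using fun_cong[OF fun_cong[OF pre_scaleH[OF f assms(2)]]] by (simp add: insH_def scl_def)
  then show ?thesis
    by (simp add: contr_def scl_def fun_eq_iff V.scale_sum_right mult.commute)
qed

lemma Lie_add_left: assumes f: "precochain f" shows "Lie (a + b) f = Lie a f + Lie b f"
  by (auto simp: Lie_def fun_eq_iff tau_add br_add_left sum.distrib pre_add_nth[OF f]
      pre_addH_nth[OF f] ideal_right subset_iff)

lemma Lie_scale_left: assumes f: "precochain f" shows "Lie (sL c a) f = scl c (Lie a f)"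
  by (auto simp: Lie_def scl_def fun_eq_iff tau_scale br_scale_left V.scale_sum_right
      pre_scale_nth[OF f] pre_scaleH_nth[OF f] ideal_right subset_iff V.scale_right_diff_distrib)

lemma insH_zero: assumes f: "precochain f" shows "insH 0 f = 0"
  using pre_scaleH[OF f subspace_0[OF subspace_H], of 0] by (simp add: scl_zero_left)

lemma contr_zero_fun: assumes f: "precochain f" shows "contr (\<lambda>x. 0) f = 0"
  using fun_cong[OF fun_cong[OF insH_zero[OF f]]] by (simp add: contr_def fun_eq_iff insH_def)

text \<open>Left multiplication by a symmetric product is zero, so \<open>br (br h e)\<close> and
  \<open>br (br e h)\<close> are opposite.\<close>

lemma contr_br_symprod:
  assumes f: "precochain f" and h: "h \<in> H"
  shows "contr (br (br e h)) f + contr (br (br h e)) f = 0"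
proof -
  have "contr (br (br e h)) f + contr (br (br h e)) f = contr (\<lambda>x. br (symprod br e h) x) f"
    using h by (simp add: symprod_def br_add_left contr_plus_fun[OF f] ideal_left ideal_right)
  then show ?thesis by (simp add: br_symprod contr_zero_fun[OF f])
qed

lemma precochain_cobd [intro]: assumes f: "precochain f" shows "precochain (cobd f)"
proof (rule precochain_operatorI[where A=cobd, OF _ _ _ _ _ _ _ _ f])
  fix f assume f: "precochain f"
  show "cobd f es hs = 0" if "\<not> set hs \<subseteq> H" for es hs
    using that by (simp add: cobd_def)
  show "insE (a + b) (cobd f) = insE a (cobd f) + insE b (cobd f)" for a b
    by (simp add: insE_cobd[OF f] pre_addE[OF f] Lie_add_left[OF f] cobd_add)
  show "insE (sL c a) (cobd f) = scl c (insE a (cobd f))" for c a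
    by (simp add: insE_cobd[OF f] pre_scaleE[OF f] Lie_scale_left[OF f] cobd_scl scl_diff)
  show "insH (a + b) (cobd f) = insH a (cobd f) + insH b (cobd f)" if "a \<in> H" "b \<in> H" for a b
    using that by (simp add: insH_cobd[OF f] pre_addH[OF f] cobd_add pre_addE[OF f] ideal_left
      subspace_add[OF subspace_H] br_add_left[abs_def] contr_plus_fun[OF f])
  show "insH (sL c a) (cobd f) = scl c (insH a (cobd f))" if "a \<in> H" for c a
    using that by (simp add: insH_cobd[OF f] pre_scaleH[OF f] cobd_scl pre_scaleE[OF f] ideal_left
      subspace_scale[OF subspace_H] br_scale_left[abs_def] contr_scale_fun[OF f] scl_add)
  show "cobd f es hs = cobd f es hs'" if m: "mset hs = mset hs'" for es hs hs'
  proof -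
    have "(\<Sum>j<length hs. f es (hs[j := br (hs ! j) e]))
        = (\<Sum>j<length hs'. f es (hs'[j := br (hs' ! j) e]))" for e es
      using sum_omit_mset_cong[of "\<lambda>h l. f es (br h e # l)", OF pre_sym_Cons[OF f] m]
      by (simp add: pre_update[OF f])
    moreover have "(\<Sum>j<length hs. f (hs ! j # es) (omit j hs)) = (\<Sum>j<length hs'. f (hs' ! j # es) (omit j hs'))" for es
      using sum_omit_mset_cong[of "\<lambda>h l. f (h # es) l", OF pre_sym[OF f] m] .
    ultimately show ?thesis
      using mset_eq_setD[OF m] pre_sym[OF f m] unfolding cobd_def
      by (simp flip: V.scale_sum_right)
  qed
  show "insE a (insE b (cobd f)) + insE b (insE a (cobd f)) = - insH (symprod br a b) (cobd f)" for a b
  proof -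
    \<comment> \<open>The Lie derivatives cancel when the same equation with \<open>a\<close> and
      \<open>b\<close> exchanged is added. The insertions of the two brackets add up to that of
      \<open>symprod br a b\<close>, which is the extra term in \<open>insH_cobd\<close>; the
      contraction there is zero.\<close>
    have 1: "insE a (insE b (cobd f)) = Lie b (insE a f) - insE (br b a) f - Lie a (insE b f)
         + cobd (insE a (insE b f))" for a b
      by (simp add: insE_cobd insE_Lie f precochain_insE)
    have "insE a (insE b (cobd f)) + insE b (insE a (cobd f))
        = cobd (insE a (insE b f) + insE b (insE a f)) - (insE (br a b) f + insE (br b a) f)"
      unfolding 1 cobd_add by (simp add: algebra_simps)
    also have "insE (br a b) f + insE (br b a) f = insE (symprod br a b) f"
      by (simp add: pre_addE[OF f] symprod_def)
    also have "contr (br (symprod br a b)) f = 0"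
      using contr_zero_fun[OF f] by (simp add: br_symprod[abs_def])
    then have "cobd (insE a (insE b f) + insE b (insE a f)) - insE (symprod br a b) f
        = - insH (symprod br a b) (cobd f)"
      unfolding insE_insE[OF f] cobd_minus insH_cobd[OF f symprod_H] by simp
    finally show ?thesis .
  qed
  show "\<exists>g. precochain g \<and> (insE x (cobd f) = cobd (insE x f) + g \<or>
      insE x (cobd f) = g - cobd (insE x f))" for x
    by (rule exI[of _ "Lie x f"]) (auto simp: insE_cobd f)
qed


section \<open>Relations between Lie derivative, contraction and differential\<close>

lemmas precochain_ops = precochain_add precochain_diff precochain_minus precochain_insE
  precochain_insH precochain_Lie precochain_contr precochain_cobd precochain_scl

text \<open>Without arguments this is the representation property of \<open>\<tau>\<close>; for an
  insertion of either kind it is the Leibniz identity.\<close>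

lemma Lie_Lie:
  assumes f: "precochain f"
  shows "Lie a (Lie b f) - Lie b (Lie a f) = Lie (br a b) f"
proof -
  have "Lie a (Lie b f) - Lie b (Lie a f) - Lie (br a b) f = 0"
  proof (rule operator_eqI[OF _ _ _ _ f,
        where R = "\<lambda>f. Lie a (Lie b f) - Lie b (Lie a f) - Lie (br a b) f"])
    fix f assume f: "precochain f"
    let ?R = "\<lambda>f. Lie a (Lie b f) - Lie b (Lie a f) - Lie (br a b) f"
    show "?R f es hs = 0" if "\<not> set hs \<subseteq> H" for es hs
      using that by (simp add: Lie_def)
    show "?R f [] [] = 0"
      by (simp add: Lie_def tau_bracket)
    have "br (br a b) x = br a (br b x) - br b (br a x)" for x
      by (simp add: leibniz[of a b x])
    then show "insE e (?R f) = ?R (insE e f) \<or> insE e (?R f) = - ?R (insE e f)" for e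
      using pre_addE[OF f, of "br (br a b) e" "br b (br a e)"]
      by (intro disjI1) (simp add: insE_Lie precochain_ops f op_linear algebra_simps)
    show "insH h (?R f) = ?R (insH h f)" if h: "h \<in> H" for h
      using h pre_addH[OF f, of "br (br a b) h" "br b (br a h)"] leibniz[of a b h]
      by (simp add: insH_Lie precochain_ops f op_linear ideal_right ideal_left algebra_simps)
  qed
  then show ?thesis by simp
qed

lemma Lie_contr:
  assumes g: "linear_into_H g" and f: "precochain f"
  shows "Lie e (contr g f) - contr g (Lie e f) = contr (\<lambda>x. br e (g x) - g (br e x)) f"
proof -
  let ?g = "\<lambda>x. br e (g x) - g (br e x)"
  note g' = linear_into_H_commutator[OF g, of e]
  have "Lie e (contr g f) - contr g (Lie e f) - contr ?g f = 0"
  proof (rule operator_eqI[OF _ _ _ _ f,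
        where R = "\<lambda>f. Lie e (contr g f) - contr g (Lie e f) - contr ?g f"])
    fix f assume f: "precochain f"
    let ?R = "\<lambda>f. Lie e (contr g f) - contr g (Lie e f) - contr ?g f"
    show "?R f es hs = 0" if "\<not> set hs \<subseteq> H" for es hs
      using that by (simp add: Lie_def contr_def pre_supp[OF f])
    show "?R f [] [] = 0"
      by (simp add: Lie_def contr_def)
    \<comment> \<open>Each summand of \<open>?R\<close> contains exactly one odd operator, hence the
      minus sign.\<close>
    show "insE x (?R f) = ?R (insE x f) \<or> insE x (?R f) = - ?R (insE x f)" for x
      using pre_addH[OF f linH_mem[OF g'] linH_mem[OF g], of x "br e x"]
      by (intro disjI2) (simp add: insE_Lie insE_contr insH_Lie linH_mem[OF g] precochain_ops f g
          op_linear algebra_simps)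
    show "insH h (?R f) = ?R (insH h f)" if h: "h \<in> H" for h
      using h by (simp add: insH_Lie insH_contr precochain_ops f g op_linear ideal_right)
  qed
  then show ?thesis by simp
qed

text \<open>Two moved entries commute in the symmetric part, while the signs of the two omissions
  change with their order.\<close>

lemma contr_contr:
  assumes g: "linear_into_H g" and g': "linear_into_H g'" and f: "precochain f"
  shows "contr g (contr g' f) + contr g' (contr g f) = 0"
proof (rule operator_eqI[OF _ _ _ _ f])
  fix f assume f: "precochain f"
  let ?R = "\<lambda>f. contr g (contr g' f) + contr g' (contr g f)"
  show "?R f es hs = 0" if "\<not> set hs \<subseteq> H" for es hs
    using that by (simp add: contr_def pre_supp[OF f])
  show "?R f [] [] = 0"
    by (simp add: contr_def)
  show "insE x (?R f) = ?R (insE x f) \<or> insE x (?R f) = - ?R (insE x f)" for x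
    by (intro disjI1) (simp add: insE_contr insH_contr precochain_ops f g g' op_linear)
  show "insH h (?R f) = ?R (insH h f)" if h: "h \<in> H" for h
    using h by (simp add: insH_contr precochain_ops f g g')
qed

text \<open>Two choices of \<open>g\<close> matter: a projection onto \<open>H\<close>, for the
  homotopy, and \<open>br h\<close>, for the proof that \<open>d\<close> squares to zero.\<close>

definition laplacian :: "('l \<Rightarrow> 'l) \<Rightarrow> ('l list \<Rightarrow> 'l list \<Rightarrow> 'v) \<Rightarrow> 'l list \<Rightarrow> 'l list \<Rightarrow> 'v" where
  "laplacian g f = cobd (contr g f) + contr g (cobd f)"

lemma precochain_laplacian [intro]:
  "linear_into_H g \<Longrightarrow> precochain f \<Longrightarrow> precochain (laplacian g f)"
  by (simp add: laplacian_def precochain_ops)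

text \<open>For a projection \<open>g\<close> the term \<open>insE (g e) f\<close> counts the
  argument \<open>e\<close> if it lies in \<open>H\<close>. Both contractions evaluate
  \<open>f\<close> with one more symmetric argument, so they are off-diagonal; they come from the
  commutator of \<open>Lie e\<close> with \<open>contr g\<close> and from inserting
  \<open>g e\<close> into the differential.\<close>

lemma insE_laplacian:
  assumes g: "linear_into_H g" and f: "precochain f"
  shows "insE e (laplacian g f) = laplacian g (insE e f) + insE (g e) f
    + contr (\<lambda>x. br e (g x) - g (br e x)) f + contr (br (g e)) f"
  by (simp add: laplacian_def insE_cobd insE_contr insH_cobd linH_mem[OF g] precochain_ops f g
      op_linear Lie_contr[OF g f, symmetric])

text \<open>The contractions along \<open>g\<close> and \<open>br h\<close> anticommute, so nothing
  off-diagonal remains here; for a projection \<open>g\<close> the extra term counts the symmetric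
  argument \<open>h\<close>.\<close>

lemma insH_laplacian:
  assumes g: "linear_into_H g" and f: "precochain f" and h: "h \<in> H"
  shows "insH h (laplacian g f) = laplacian g (insH h f) + insH (g h) f"
  using contr_contr[OF g linear_into_H_br[OF h] f]
  by (simp add: laplacian_def insH_cobd insH_contr insE_contr precochain_ops f g h op_linear
     algebra_simps)

text \<open>A second Cartan formula, for contraction along \<open>br h\<close>. Without arguments
  both sides vanish because \<open>\<tau>\<close> kills \<open>H\<close>. After an insertion of
  \<open>e\<close> the two contractions are along \<open>br (br e h)\<close> and
  \<open>br (br h e)\<close> and cancel.\<close>

lemma laplacian_br:
  assumes h: "h \<in> H" and f: "precochain f"
  shows "laplacian (br h) f = - Lie h f"
proof -
  note g = linear_into_H_br[OF h]
  have "laplacian (br h) f + Lie h f = 0"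
  proof (rule operator_eqI[OF _ _ _ _ f, where R = "\<lambda>f. laplacian (br h) f + Lie h f"])
    fix f assume f: "precochain f"
    let ?R = "\<lambda>f. laplacian (br h) f + Lie h f"
    show "?R f es hs = 0" if "\<not> set hs \<subseteq> H" for es hs
      using that by (simp add: Lie_def contr_def laplacian_def cobd_def)
    show "?R f [] [] = 0"
      by (simp add: Lie_def contr_def laplacian_def cobd_def tau_H h)
    have "br e (br h x) - br h (br e x) = br (br e h) x" for e x
      by (simp add: leibniz[of e h x])
    then show "insE e (?R f) = ?R (insE e f) \<or> insE e (?R f) = - ?R (insE e f)" for e
      using contr_br_symprod[OF f h, of e]
      by (intro disjI1) (simp add: insE_laplacian[OF g f] insE_Lie[OF f] add.assoc)
    show "insH h' (?R f) = ?R (insH h' f)" if h': "h' \<in> H" for h'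
      using h' by (simp add: insH_laplacian[OF g f] insH_Lie f)
  qed
  then show ?thesis by (simp add: eq_neg_iff_add_eq_0)
qed

text \<open>For an insertion in the first list, Cartan's formula reduces the claim to
  \<open>Lie_Lie\<close>. For a symmetric argument \<open>h\<close> the contraction along
  \<open>br h\<close> is transported by \<open>Lie_contr\<close>, the commutator of
  \<open>br e\<close> and \<open>br h\<close> being \<open>br (br e h)\<close>.\<close>

lemma Lie_cobd:
  assumes f: "precochain f"
  shows "Lie e (cobd f) = cobd (Lie e f)"
proof -
  have "Lie e (cobd f) - cobd (Lie e f) = 0"
  proof (rule operator_eqI[OF _ _ _ _ f, where R = "\<lambda>f. Lie e (cobd f) - cobd (Lie e f)"])
    fix f assume f: "precochain f"
    let ?R = "\<lambda>f. Lie e (cobd f) - cobd (Lie e f)"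
    show "?R f es hs = 0" if "\<not> set hs \<subseteq> H" for es hs
      using that by (simp add: Lie_def cobd_def)
    show "?R f [] [] = 0"
      by (simp add: Lie_def cobd_def)
    show "insE x (?R f) = ?R (insE x f) \<or> insE x (?R f) = - ?R (insE x f)" for x
      using Lie_Lie[OF f, of e x, symmetric]
      by (intro disjI2) (simp add: insE_cobd insE_Lie precochain_ops f op_linear)
    show "insH h (?R f) = ?R (insH h f)" if h: "h \<in> H" for h
    proof -
      have "br e (br h x) - br h (br e x) = br (br e h) x" for x
        by (simp add: leibniz[of e h x])
      then have "Lie e (contr (br h) f) - contr (br h) (Lie e f) = contr (br (br e h)) f"
        using Lie_contr[OF linear_into_H_br[OF h] f, of e] by simp
      then show ?thesis
        using h by (simp add: insH_cobd insH_Lie insE_Lie precochain_ops f op_linear ideal_right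
            linear_into_H_br algebra_simps)
    qed
  qed
  then show ?thesis by simp
qed

text \<open>Inserting \<open>h\<close> leaves the two Cartan expressions, \<open>Lie h f\<close>
  from \<open>insE h\<close> and \<open>- Lie h f\<close> from \<open>contr (br h)\<close>, whose
  sum is zero.\<close>

lemma cobd_cobd:
  assumes f: "precochain f"
  shows "cobd (cobd f) = 0"
proof (rule operator_eqI[OF _ _ _ _ f])
  fix f assume f: "precochain f"
  show "cobd (cobd f) es hs = 0" if "\<not> set hs \<subseteq> H" for es hs
    using that by (simp add: cobd_def)
  show "cobd (cobd f) [] [] = 0"
    by (simp add: cobd_def)
  show "insE x (cobd (cobd f)) = cobd (cobd (insE x f)) \<or> insE x (cobd (cobd f)) = - cobd (cobd (insE x f))" for x
    by (simp add: insE_cobd precochain_ops f op_linear Lie_cobd)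
  show "insH h (cobd (cobd f)) = cobd (cobd (insH h f))" if h: "h \<in> H" for h
    using laplacian_br[OF h f] h
    by (simp add: insH_cobd insE_cobd precochain_ops f op_linear linear_into_H_br laplacian_def
        algebra_simps eq_neg_iff_add_eq_0)
qed


section \<open>Reduction to basic cochains\<close>

text \<open>Omitting entries or replacing one by an element of \<open>H\<close> never increases this
  number. It is therefore the arguments outside \<open>H\<close>, not those inside, that give a
  filtration.\<close>

definition outside :: "'l list \<Rightarrow> nat" where
  "outside es = length (filter (\<lambda>e. e \<notin> H) es)"

lemma outside_simps [simp]:
  "outside [] = 0" "outside (e # es) = (if e \<in> H then outside es else Suc (outside es))"
  by (simp_all add: outside_def)

lemma outside_le_length: "outside es \<le> length es"
  by (simp add: outside_def)

lemma outside_omit: "outside (omit i es) \<le> outside es"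
  by (induction es arbitrary: i) (auto simp: omit_def outside_def take_Cons drop_Cons split: nat.splits)

lemma contr_vanish:
  assumes "\<And>es' hs'. outside es' \<le> outside es \<Longrightarrow> length hs' = Suc (length hs) \<Longrightarrow> f es' hs' = 0"
  shows "contr g f es hs = 0"
  by (simp add: contr_def assms outside_omit)

text \<open>The two vanishing hypotheses remove the off-diagonal terms: \<open>v1\<close> the
  contractions, \<open>v2\<close> the replacement of an entry outside \<open>H\<close> by its
  projection. What remains adds one for each argument in \<open>H\<close>, in either list.\<close>

lemma laplacian_diagonal:
  assumes P: "linear_into_H P" and PH: "\<And>h. h \<in> H \<Longrightarrow> P h = h" and f: "precochain f"
    and v1: "\<And>es' hs'. outside es' \<le> outside es \<Longrightarrow> length hs' = Suc (length hs) \<Longrightarrow> f es' hs' = 0"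
    and v2: "\<And>es' hs'. outside es' < outside es \<Longrightarrow> length hs' = length hs \<Longrightarrow> f es' hs' = 0"
  shows "laplacian P f es hs = sV (of_nat (length hs + (length es - outside es))) (f es hs)"
  using f v1 v2
proof (induction es arbitrary: f)
  case Nil
  then show ?case
  proof (induction hs arbitrary: f)
    case Nil
    then show ?case by (simp add: laplacian_def cobd_def contr_def)
  next
    case (Cons h hs)
    show ?case
    proof (cases "h \<in> H")
      case True
      have "laplacian P f [] (h # hs) = laplacian P (insH h f) [] hs + f [] (h # hs)"
        using fun_cong[OF fun_cong[OF insH_laplacian[OF P Cons.prems(1) True]], of "[]" hs]
        by (simp add: insH_def PH True)
      also have "laplacian P (insH h f) [] hs = sV (of_nat (length hs)) (f [] (h # hs))"
        using Cons.IH[OF precochain_insH[OF Cons.prems(1) True]] Cons.prems(2)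
        by (simp add: insH_def)
      finally show ?thesis by (simp add: V.scale_left_distrib)
    next
      case False
      then show ?thesis
        using pre_supp[OF precochain_laplacian[OF P Cons.prems(1)], of "h # hs"]
          pre_supp[OF Cons.prems(1), of "h # hs"] by simp
    qed
  qed
next
  case (Cons e es)
  have c: "contr g f es hs = 0" for g
    using Cons.prems(2) by (intro contr_vanish) auto
  have "laplacian P f (e # es) hs = laplacian P (insE e f) es hs + f (P e # es) hs"
    using fun_cong[OF fun_cong[OF insE_laplacian[OF P Cons.prems(1), of e], of es], of hs]
    by (simp add: insE_def c)
  also have "laplacian P (insE e f) es hs
      = sV (of_nat (length hs + (length es - outside es))) (f (e # es) hs)"
    using Cons.IH[OF precochain_insE[OF Cons.prems(1)], of e] Cons.prems(2,3)
    by (simp add: insE_def)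
  \<comment> \<open>If \<open>e\<close> is outside \<open>H\<close>, then \<open>P e # es\<close>
    has fewer entries outside than \<open>e # es\<close>, and \<open>v2\<close> applies.\<close>
  also have "f (P e # es) hs = (if e \<in> H then f (e # es) hs else 0)"
    using Cons.prems(3) by (simp add: PH linH_mem[OF P])
  finally show ?case
    using outside_le_length[of es] by (simp add: Suc_diff_le V.scale_left_distrib algebra_simps)
qed

section \<open>Total degree, basic cochains and the filtration\<close>

definition has_degree :: "nat \<Rightarrow> ('l list \<Rightarrow> 'l list \<Rightarrow> 'v) \<Rightarrow> bool" where
  "has_degree n f \<longleftrightarrow> (\<forall>es hs. f es hs \<noteq> 0 \<longrightarrow> length es + 2 * length hs = n)"

lemma has_degreeD: "has_degree n f \<Longrightarrow> length es + 2 * length hs \<noteq> n \<Longrightarrow> f es hs = 0"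
  by (auto simp: has_degree_def)

lemma has_degree_add: "has_degree n f \<Longrightarrow> has_degree n g \<Longrightarrow> has_degree n (f + g)"
  and has_degree_diff: "has_degree n f \<Longrightarrow> has_degree n g \<Longrightarrow> has_degree n (f - g)"
  and has_degree_scl: "has_degree n f \<Longrightarrow> has_degree n (scl c f)"
  and has_degree_zero: "has_degree n 0"
  unfolding has_degree_def scl_def by auto (metis add_0_left right_minus_eq)+

lemma has_degree_contr: "has_degree (Suc n) f \<Longrightarrow> has_degree n (contr g f)"
  unfolding has_degree_def[of n]
proof (intro allI impI, rule ccontr)
  fix es hs
  assume f: "has_degree (Suc n) f" and n: "contr g f es hs \<noteq> 0" "length es + 2 * length hs \<noteq> n"
  have "f (omit a es) (h # hs) = 0" if "a < length es" for a h
    using that n(2) by (intro has_degreeD[OF f]) (auto simp: length_omit)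
  then show False using n(1) by (simp add: contr_def)
qed

lemma contr_degree_zero: "has_degree 0 f \<Longrightarrow> contr g f = 0"
  by (simp add: contr_def fun_eq_iff has_degreeD)

lemma cobd_zero: "cobd 0 = 0"
  using cobd_scl[of 0 0] by (simp add: scl_zero_left)

lemma has_degree_cobd: "has_degree n f \<Longrightarrow> has_degree (Suc n) (cobd f)"
  unfolding has_degree_def[of "Suc n"]
proof (intro allI impI, rule ccontr)
  fix es hs
  assume f: "has_degree n f" and n: "cobd f es hs \<noteq> 0" "length es + 2 * length hs \<noteq> Suc n"
  have "f (omit a es') hs' = 0" if "a < length es" "length es' = length es" "length hs' = length hs" for a es' hs'
    using that n(2) by (intro has_degreeD[OF f]) (auto simp: length_omit)
  moreover have "f (e # es) (omit j hs) = 0" if "j < length hs" for e j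
    using that n(2) by (intro has_degreeD[OF f]) (auto simp: length_omit)
  ultimately have "(\<Sum>b<length es. \<Sum>a<b. sV ((-1) ^ Suc a)
        (f (omit a (es[b := br (es ! a) (es ! b)])) hs)) = 0"
      "(\<Sum>a<length es. sV ((-1) ^ a) (\<tau> (es ! a) (f (omit a es) hs))) = 0"
      "(\<Sum>j<length hs. f (hs ! j # es) (omit j hs)) = 0"
      "(\<Sum>a<length es. \<Sum>j<length hs.
        sV ((-1) ^ a) (f (omit a es) (hs[j := br (hs ! j) (es ! a)]))) = 0"
    by (auto intro!: sum.neutral)
  then show False using n(1) by (simp add: cobd_def split: if_splits)
qed

definition horizontal :: "('l list \<Rightarrow> 'l list \<Rightarrow> 'v) \<Rightarrow> bool" where
  "horizontal f \<longleftrightarrow> precochain f \<and> (\<forall>es hs. hs \<noteq> [] \<or> set es \<inter> H \<noteq> {} \<longrightarrow> f es hs = 0)"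

lemma horizontal_zero: "horizontal f \<Longrightarrow> hs \<noteq> [] \<or> set es \<inter> H \<noteq> {} \<Longrightarrow> f es hs = 0"
  unfolding horizontal_def by blast

definition basic :: "nat \<Rightarrow> ('l list \<Rightarrow> 'l list \<Rightarrow> 'v) \<Rightarrow> bool" where
  "basic n f \<longleftrightarrow> horizontal f \<and> has_degree n f"

lemma basicD: "basic n f \<Longrightarrow> precochain f" "basic n f \<Longrightarrow> has_degree n f"
  by (simp_all add: basic_def horizontal_def)

lemma basic_scl: "basic n f \<Longrightarrow> basic n (scl c f)"
  unfolding basic_def horizontal_def by (auto simp: has_degree_scl precochain_scl) (auto simp: scl_def)

lemma contr_basic: "basic n f \<Longrightarrow> contr g f = 0"
  by (simp add: contr_def basic_def horizontal_def fun_eq_iff)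

text \<open>The steps are taken with \<open>p\<close> increasing and, for fixed \<open>p\<close>,
  with \<open>r\<close> decreasing; \<open>filtered p 0\<close> means that nothing with at most
  \<open>p\<close> outside arguments is left.\<close>

definition filtered :: "nat \<Rightarrow> nat \<Rightarrow> ('l list \<Rightarrow> 'l list \<Rightarrow> 'v) \<Rightarrow> bool" where
  "filtered p r f \<longleftrightarrow>
     (\<forall>es hs. outside es < p \<or> outside es = p \<and> r \<le> length hs \<longrightarrow> f es hs = 0)"

lemma filtered_laplacian:
  assumes P: "linear_into_H P" and PH: "\<And>h. h \<in> H \<Longrightarrow> P h = h" and f: "precochain f"
    and n: "has_degree n f" and F: "filtered p (Suc r) f"
  shows "filtered p r (laplacian P f - scl (of_nat (n - p - r)) f)"
  unfolding filtered_def
proof (intro allI impI)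
  fix es hs :: "'l list" assume c: "outside es < p \<or> outside es = p \<and> r \<le> length hs"
  have "laplacian P f es hs = sV (of_nat (length hs + (length es - outside es))) (f es hs)"
    using F c by (intro laplacian_diagonal[OF P PH f]) (auto simp: filtered_def le_less)
  \<comment> \<open>Where \<open>f\<close> does not vanish in this range, there are exactly
    \<open>p\<close> outside and \<open>r\<close> symmetric arguments, and the degree determines how
    many entries lie in \<open>H\<close>.\<close>
  moreover have "length hs + (length es - outside es) = n - p - r" if "f es hs \<noteq> 0"
  proof -
    have "outside es = p \<and> r \<le> length hs \<and> \<not> Suc r \<le> length hs"
      using that F c unfolding filtered_def by blast
    moreover have "length es + 2 * length hs = n"
      using that n by (simp add: has_degree_def)
    ultimately show ?thesis using outside_le_length[of es] by linarith
  qed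
  ultimately show "(laplacian P f - scl (of_nat (n - p - r)) f) es hs = 0"
    by (cases "f es hs = 0") (auto simp: scl_def)
qed

lemma projection_onto_H: "\<exists>P. linear_into_H P \<and> (\<forall>h\<in>H. P h = h)"
proof -
  interpret vector_space_pair sL sL by unfold_locales
  obtain g where g: "g ` UNIV \<subseteq> H" "Vector_Spaces.linear sL sL g" "\<forall>v\<in>H. g (id v) = v"
    using linear_exists_left_inverse_on[of id H] linear_id subspace_H by auto
  then have "linear_into_H g"
    using module_hom.add[OF Vector_Spaces.linear.axioms(3)[OF g(2)]]
      module_hom.scale[OF Vector_Spaces.linear.axioms(3)[OF g(2)]]
    by (auto simp: linear_into_H_def)
  then show ?thesis using g(3) by auto
qed

text \<open>On the \<open>(p, r)\<close>-th step of the filtration the Laplacian acts as the scalar \<open>n - p - r\<close> modulo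
  the next step, and it acts as a coboundary on cochains with basic differential. Hence all
  steps with a nonzero scalar can be cleared.\<close>

lemma filtered_decomposition:
  assumes P: "linear_into_H P" and PH: "\<forall>h\<in>H. P h = h"
  shows "precochain f \<Longrightarrow> has_degree n f \<Longrightarrow> basic (Suc n) (cobd f) \<Longrightarrow> filtered p r f \<Longrightarrow> p \<le> n \<Longrightarrow>
    \<exists>a g. basic n a \<and> precochain g \<and> (case n of 0 \<Rightarrow> g = 0 | Suc m \<Rightarrow> has_degree m g) \<and> f = a + cobd g"
proof (induction "n - p" arbitrary: f p r)
  case 0
  \<comment> \<open>Here \<open>p = n\<close>. Where \<open>f\<close> is nonzero at least
    \<open>n\<close> entries lie outside \<open>H\<close>, and degree \<open>n\<close> leaves no
    room for further entries or for symmetric arguments.\<close>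
  have b: "basic n f"
    unfolding basic_def horizontal_def
  proof (intro conjI allI impI 0)
    fix es hs :: "'l list" assume c: "hs \<noteq> [] \<or> set es \<inter> H \<noteq> {}"
    show "f es hs = 0"
    proof (rule ccontr)
      assume nz: "f es hs \<noteq> 0"
      then have "length es + 2 * length hs = n" "\<not> outside es < n"
        using 0 by (auto simp: has_degree_def filtered_def)
      then have "length hs = 0" and e: "outside es = length es"
        using outside_le_length[of es] by linarith+
      moreover have "filter (\<lambda>e. e \<notin> H) es = es"
        using e unfolding outside_def by (metis filter_True length_filter_less nat_less_le)
      ultimately show False using c by (auto simp: filter_id_conv)
    qed
  qed
  have c: "case n of 0 \<Rightarrow> 0 = 0 | Suc m \<Rightarrow> has_degree m 0"
    by (simp add: has_degree_zero split: nat.split)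
  have "f = f + cobd 0"
    unfolding cobd_zero by (rule add_0_right[symmetric])
  with b c show ?case
    using precochain_zero by blast
next
  case (Suc d)
  from Suc.prems show ?case
  proof (induction r arbitrary: f)
    case 0
    \<comment> \<open>The next value of \<open>p\<close> can start at \<open>r = Suc n\<close>,
      because degree \<open>n\<close> excludes more than \<open>n\<close> symmetric
      arguments.\<close>
    then have "filtered (Suc p) (Suc n) f"
      using has_degreeD[OF 0(2)] by (auto simp: filtered_def less_Suc_eq)
    moreover have "d = n - Suc p" "Suc p \<le> n" using Suc.hyps(2) by auto
    ultimately show ?case
      using Suc.hyps(1)[OF _ 0(1-3)] by blast
  next
    case (Suc r)
    let ?q = "n - p - r"
    show ?case
    proof (cases "?q = 0")
      case True
      \<comment> \<open>This step is empty: \<open>r\<close> is at least \<open>n - p\<close>, which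
        is positive, so such arguments would have degree at least
        \<open>p + 2 * r > n\<close>.\<close>
      have "f es hs = 0" if "outside es = p" "length hs = r" for es hs
        using that outside_le_length[of es] True \<open>Suc d = n - p\<close>
        by (intro has_degreeD[OF Suc.prems(2)]) auto
      then have "filtered p r f"
        using Suc.prems(4) by (auto simp: filtered_def Suc_le_eq) (metis le_neq_implies_less)
      then show ?thesis using Suc.IH[of f] Suc.prems by blast
    next
      case False
      define q :: 'k where "q = of_nat ?q"
      have q: "q \<noteq> 0" unfolding q_def by (rule contrapos_nn[OF False of_nat_eq_0])
      note f = Suc.prems(1) and b = Suc.prems(3)
      have lap: "laplacian P f = cobd (contr P f)"
        by (simp add: laplacian_def contr_basic[OF b])
      \<comment> \<open>\<open>?f\<close> lies one step further and still has basic differential,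
        since \<open>laplacian P f\<close> is a coboundary. Solving the decomposition of
        \<open>?f\<close> for \<open>scl q f\<close> and dividing by \<open>q\<close> gives that of
        \<open>f\<close>.\<close>
      let ?f = "laplacian P f - scl q f"
      have pf: "precochain ?f" by (simp add: precochain_ops f P precochain_laplacian)
      have df: "case n of 0 \<Rightarrow> contr P f = 0 | Suc m \<Rightarrow> has_degree m (contr P f)"
        using Suc.prems(2) by (auto split: nat.splits simp: has_degree_contr contr_degree_zero)
      then have "has_degree n (laplacian P f)"
        unfolding lap by (cases n) (simp_all add: has_degree_cobd cobd_zero has_degree_zero)
      then have nf: "has_degree n ?f"
        using Suc.prems(2) by (simp add: has_degree_diff has_degree_scl)
      have "cobd ?f = scl (- q) (cobd f)"
        by (simp add: lap op_linear cobd_cobd precochain_ops P f) (simp add: scl_def fun_eq_iff)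
      then have bf: "basic (Suc n) (cobd ?f)" using b by (simp add: basic_scl)
      have "filtered p r ?f"
        unfolding q_def by (rule filtered_laplacian[OF P _ f Suc.prems(2) Suc.prems(4)]) (simp add: PH)
      then obtain a g where a: "basic n a" and g: "precochain g"
        "case n of 0 \<Rightarrow> g = 0 | Suc m \<Rightarrow> has_degree m g" and fag: "?f = a + cobd g"
        using Suc.IH[OF pf nf bf _ Suc.prems(5)] by blast
      have "scl q f = scl (-1) a + cobd (contr P f - g)"
        using fag by (simp add: lap cobd_diff scl_neg_one algebra_simps)
      then have "scl (inverse q) (scl q f) = scl (- inverse q) a + cobd (scl (inverse q) (contr P f - g))"
        by (simp add: scl_add scl_scl cobd_scl)
      moreover have "scl (inverse q) (scl q f) = f"
        using q by (simp add: scl_def)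
      ultimately have "f = scl (- inverse q) a + cobd (scl (inverse q) (contr P f - g))"
        by (rule trans[OF sym, rotated])
      moreover have "case n of 0 \<Rightarrow> scl (inverse q) (contr P f - g) = 0
          | Suc m \<Rightarrow> has_degree m (scl (inverse q) (contr P f - g))"
        using df g(2) by (auto split: nat.splits simp: scl_zero has_degree_diff has_degree_scl)
      ultimately show ?thesis
        using basic_scl[OF a] precochain_scl[OF precochain_diff[OF precochain_contr[OF P f] g(1)]]
        by (intro exI conjI)
    qed
  qed
qed

text \<open>Acyclicity modulo basic cochains. It is applied to cocycles for surjectivity, and to a
  \<open>g\<close> whose differential is a pulled-back cocycle for injectivity.\<close>

lemma basic_decomposition:
  assumes f: "precochain f" "has_degree n f" "basic (Suc n) (cobd f)"
  obtains a g where "basic n a" "precochain g" "case n of 0 \<Rightarrow> g = 0 | Suc m \<Rightarrow> has_degree m g"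
    "f = a + cobd g"
proof -
  obtain P where P: "linear_into_H P" and PH: "\<forall>h\<in>H. P h = h"
    using projection_onto_H by blast
  have "filtered 0 (Suc n) f"
    using has_degreeD[OF f(2)] by (auto simp: filtered_def)
  from filtered_decomposition[OF P PH f this le0] show ?thesis
    by (elim exE conjE) (rule that)
qed


section \<open>The two complexes\<close>

definition pack :: "('l list \<Rightarrow> 'l list \<Rightarrow> 'v) \<Rightarrow> ('l, 'v) Hcochain" where
  "pack f = (\<lambda>k es hs. if length hs = k then f es hs else 0)"

definition unpack :: "('l, 'v) Hcochain \<Rightarrow> 'l list \<Rightarrow> 'l list \<Rightarrow> 'v" where
  "unpack \<omega> = (\<lambda>es hs. \<omega> (length hs) es hs)"

lemma unpack_pack [simp]: "unpack (pack f) = f"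
  by (simp add: pack_def unpack_def)

lemma pack_add: "pack (f + g) = pack f + pack g"
  and pack_minus: "pack (f - g) = pack f - pack g"
  and pack_scl: "pack (scl c f) = Hscale sV c (pack f)"
  and pack_zero: "pack 0 = 0"
  by (auto simp: pack_def scl_def Hscale_def fun_eq_iff)

text \<open>The division and the truncated subtraction become one linear equation, the one in
  \<open>has_degree\<close>.\<close>

lemma Hdom_iff: "Hdom H n k es hs \<longleftrightarrow> length hs = k \<and> set hs \<subseteq> H \<and> length es + 2 * length hs = n"
  unfolding Hdom_def nlists_def by auto

lemma pack_cochain:
  assumes f: "precochain f" and n: "has_degree n f"
  shows "pack f \<in> Hcochains sL br H sV n"
  unfolding Hcochains_def
proof (intro CollectI conjI allI impI ballI)
  show "pack f k es hs = 0" if "\<not> Hdom H n k es hs" for k es hs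
    using that pre_supp[OF f] has_degreeD[OF n] by (auto simp: Hdom_iff pack_def)
  show "multilinear (subspace_vspace sL UNIV) sV (n - 2 * k) (\<lambda>es. pack f k es hs)" for k hs
    unfolding multilinear_def subspace_vspace_def vspace.simps
    by (intro ballI allI impI conjI)
      (simp_all add: pack_def nlists_def pre_add_nth[OF f] pre_scale_nth[OF f])
  show "multilinear (subspace_vspace sL H) sV k (\<lambda>hs. pack f k es hs)" for k es
    unfolding multilinear_def subspace_vspace_def vspace.simps
    by (intro ballI allI impI conjI)
      (simp_all add: pack_def nlists_def pre_addH_nth[OF f] pre_scaleH_nth[OF f])
  show "pack f k es hs = pack f k es hs'" if "mset hs = mset hs'" for k es hs hs'
    using pre_sym[OF f that] mset_eq_length[OF that] by (simp add: pack_def)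
  show "pack f k (xs @ a # b # ys) hs + pack f k (xs @ b # a # ys) hs
      = - pack f (Suc k) (xs @ ys) (symprod br a b # hs)" for k xs a b ys hs
    using pre_skew[OF f] by (simp add: pack_def)
qed

lemma
  assumes w: "\<omega> \<in> Hcochains sL br H sV n"
  shows Hcochains_supp: "\<not> Hdom H n k es hs \<Longrightarrow> \<omega> k es hs = 0"
    and Hcochains_multilinear: "k \<le> n div 2 \<Longrightarrow> hs \<in> nlists k H \<Longrightarrow>
        multilinear (subspace_vspace sL UNIV) sV (n - 2 * k) (\<lambda>es. \<omega> k es hs)"
    and Hcochains_multilinearH: "k \<le> n div 2 \<Longrightarrow> es \<in> nlists (n - 2 * k) UNIV \<Longrightarrow>
        multilinear (subspace_vspace sL H) sV k (\<lambda>hs. \<omega> k es hs)"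
    and Hcochains_sym: "mset hs = mset hs' \<Longrightarrow> \<omega> k es hs = \<omega> k es hs'"
    and Hcochains_skew: "Hdom H n k (xs @ a # b # ys) hs \<Longrightarrow>
        \<omega> k (xs @ a # b # ys) hs + \<omega> k (xs @ b # a # ys) hs
          = - \<omega> (Suc k) (xs @ ys) (symprod br a b # hs)"
  using w unfolding Hcochains_def by blast+

lemma has_degree_unpack:
  assumes w: "\<omega> \<in> Hcochains sL br H sV n"
  shows "has_degree n (unpack \<omega>)"
  using Hcochains_supp[OF w] unfolding has_degree_def unpack_def by (auto simp: Hdom_iff)

lemma pack_unpack:
  assumes w: "\<omega> \<in> Hcochains sL br H sV n"
  shows "pack (unpack \<omega>) = \<omega>"
  using Hcochains_supp[OF w] by (auto simp: pack_def unpack_def fun_eq_iff Hdom_iff)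

lemma precochain_unpack:
  assumes w: "\<omega> \<in> Hcochains sL br H sV n"
  shows "precochain (unpack \<omega>)"
proof (rule precochainI)
  note supp = Hcochains_supp[OF w]
  have E: "\<omega> (length hs) ((a + b) # es) hs = \<omega> (length hs) (a # es) hs + \<omega> (length hs) (b # es) hs \<and>
    \<omega> (length hs) (sL c a # es) hs = sV c (\<omega> (length hs) (a # es) hs)" for a b c es hs
  proof (cases "Hdom H n (length hs) (a # es) hs")
    case True
    then have "length hs \<le> n div 2" "hs \<in> nlists (length hs) H"
      by (auto simp: Hdom_def nlists_def)
    then have "multilinear (subspace_vspace sL UNIV) sV (n - 2 * length hs) (\<lambda>es. \<omega> (length hs) es hs)"
      by (rule Hcochains_multilinear[OF w])
    moreover have "a # es \<in> nlists (n - 2 * length hs) UNIV" "0 < n - 2 * length hs"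
      using True by (auto simp: Hdom_iff nlists_def)
    ultimately show ?thesis
      unfolding multilinear_def subspace_vspace_def by force
  next
    \<comment> \<open>The domain depends on the first list only through its length, so all the
      values involved vanish together.\<close>
    case False
    then show ?thesis using supp by (simp add: Hdom_iff)
  qed
  have Hl: "\<omega> (Suc (length hs)) es ((a + b) # hs)
        = \<omega> (Suc (length hs)) es (a # hs) + \<omega> (Suc (length hs)) es (b # hs) \<and>
    \<omega> (Suc (length hs)) es (sL c a # hs) = sV c (\<omega> (Suc (length hs)) es (a # hs))"
    if ab: "a \<in> H" "b \<in> H" for a b c es hs
  proof (cases "Hdom H n (Suc (length hs)) es (a # hs)")
    case True
    then have "Suc (length hs) \<le> n div 2" "es \<in> nlists (n - 2 * Suc (length hs)) UNIV"
      by (auto simp: Hdom_def nlists_def)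
    then have "multilinear (subspace_vspace sL H) sV (Suc (length hs)) (\<lambda>hs'. \<omega> (Suc (length hs)) es hs')"
      by (rule Hcochains_multilinearH[OF w])
    moreover have "a # hs \<in> nlists (Suc (length hs)) H"
      using True by (auto simp: Hdom_iff nlists_def)
    ultimately show ?thesis
      using ab unfolding multilinear_def subspace_vspace_def by force
  next
    case False
    then show ?thesis using supp ab by (simp add: Hdom_iff subspace_add[OF subspace_H]
        subspace_scale[OF subspace_H])
  qed
  show "unpack \<omega> es hs = 0" if "\<not> set hs \<subseteq> H" for es hs
    using that supp by (simp add: Hdom_iff unpack_def)
  show "insE (a + b) (unpack \<omega>) = insE a (unpack \<omega>) + insE b (unpack \<omega>)" for a b
    using E by (simp add: insE_def unpack_def fun_eq_iff)
  show "insE (sL c a) (unpack \<omega>) = scl c (insE a (unpack \<omega>))" for c a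
    using E by (simp add: insE_def unpack_def scl_def fun_eq_iff)
  show "insH (a + b) (unpack \<omega>) = insH a (unpack \<omega>) + insH b (unpack \<omega>)" if "a \<in> H" "b \<in> H" for a b
    using Hl[OF that] by (simp add: insH_def unpack_def fun_eq_iff)
  show "insH (sL c a) (unpack \<omega>) = scl c (insH a (unpack \<omega>))" if "a \<in> H" for c a
    using Hl[OF that that] by (simp add: insH_def unpack_def scl_def fun_eq_iff)
  show "unpack \<omega> es hs = unpack \<omega> es hs'" if "mset hs = mset hs'" for es hs hs'
    using Hcochains_sym[OF w that] mset_eq_length[OF that] by (simp add: unpack_def)
  show "unpack \<omega> (xs @ a # b # ys) hs + unpack \<omega> (xs @ b # a # ys) hs
      = - unpack \<omega> (xs @ ys) (symprod br a b # hs)" for xs a b ys hs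
  proof (cases "Hdom H n (length hs) (xs @ a # b # ys) hs")
    case True
    then show ?thesis using Hcochains_skew[OF w True] by (simp add: unpack_def)
  next
    \<comment> \<open>Trading two entries for one symmetric argument from \<open>H\<close> preserves
      the degree, so all three terms are outside the domain.\<close>
    case False
    then show ?thesis using supp by (auto simp: unpack_def Hdom_iff)
  qed
qed

lemma Hcochains_eq: "Hcochains sL br H sV n = pack ` {f. precochain f \<and> has_degree n f}"
proof
  show "Hcochains sL br H sV n \<subseteq> pack ` {f. precochain f \<and> has_degree n f}"
    using pack_unpack precochain_unpack has_degree_unpack by (metis (mono_tags, lifting) image_eqI mem_Collect_eq subsetI)
qed (auto intro: pack_cochain)

lemma Hdiff_pack:
  assumes f: "precochain f" and n: "has_degree n f"
  shows "Hdiff br H sV \<tau> n (pack f) = pack (cobd f)"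
proof (intro ext)
  fix k es hs
  show "Hdiff br H sV \<tau> n (pack f) k es hs = pack (cobd f) k es hs"
  proof (cases "Hdom H (Suc n) k es hs")
    case True
    then have k: "k = length hs" and hs: "set hs \<subseteq> H" by (auto simp: Hdom_iff)
    have "Hdelta (pack f) k es hs = (\<Sum>j<length hs. f (hs ! j # es) (omit j hs))"
      by (auto simp: Hdelta_def pack_def k length_omit)
    then show ?thesis
      using True hs by (simp add: Hdiff_def Hd0_def Hdprime_def cobd_def pack_def k)
  next
    case False
    then have "pack (cobd f) k es hs = 0"
      using has_degreeD[OF has_degree_cobd[OF n]] pre_supp[OF precochain_cobd[OF f]]
      by (cases "set hs \<subseteq> H") (auto simp: pack_def Hdom_iff)
    then show ?thesis using False by (simp add: Hdiff_def)
  qed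
qed

section \<open>Horizontal cochains\<close>

lemma horizontal_insE: "horizontal f \<Longrightarrow> horizontal (insE e f)"
  using horizontal_zero[of f _ "e # _"] by (simp add: horizontal_def precochain_insE) (simp add: insE_def)

text \<open>The ideal property keeps an entry in \<open>H\<close> under brackets with
  \<open>e\<close>, and for \<open>e\<close> in \<open>H\<close> it puts every bracket into
  \<open>H\<close>. Invariance under \<open>H\<close> is thus automatic, as \<open>\<tau>\<close>
  vanishes there too.\<close>

lemma Lie_horizontal:
  assumes f: "horizontal f"
  shows "set es \<inter> H \<noteq> {} \<Longrightarrow> Lie e f es hs = 0"
    and "e \<in> H \<Longrightarrow> Lie e f es [] = 0"
proof -
  note z = horizontal_zero[OF f]
  show "Lie e f es hs = 0" if es: "set es \<inter> H \<noteq> {}"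
  proof -
    obtain i where i: "i < length es" "es ! i \<in> H" using es by (auto simp: in_set_conv_nth)
    have "es[b := br e (es ! b)] ! i \<in> H" if "b < length es" for b
      using i that by (cases "b = i") (auto intro: ideal_right)
    then have "set (es[b := br e (es ! b)]) \<inter> H \<noteq> {}" if "b < length es" for b
      using i(1) that by (metis disjoint_iff length_list_update nth_mem)
    then show ?thesis using es by (simp add: Lie_def z)
  qed
  show "Lie e f es [] = 0" if "e \<in> H"
  proof -
    have "set (es[b := br e (es ! b)]) \<inter> H \<noteq> {}" if "b < length es" for b
      using set_update_memI[OF that] ideal_left[OF \<open>e \<in> H\<close>] by blast
    then show ?thesis by (simp add: Lie_def z tau_H that)
  qed
qed

text \<open>For a symmetric argument every term of \<open>insH_cobd\<close> vanishes. For the first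
  list Cartan's formula removes one entry at a time, and \<open>Lie_horizontal\<close> disposes of
  the Lie derivative.\<close>

lemma horizontal_cobd:
  assumes "horizontal f" shows "horizontal (cobd f)"
proof -
  have H0: "cobd f es hs = 0" if f: "horizontal f" and hs: "hs \<noteq> []" for f es hs
  proof -
    have p: "precochain f" using f by (simp add: horizontal_def)
    obtain h hs' where [simp]: "hs = h # hs'" using hs by (cases hs) auto
    show ?thesis
    proof (cases "h \<in> H")
      case True
      have "insH h f = 0" "insE h f = 0" "contr (br h) f = 0"
        using True by (simp_all add: insH_def insE_def contr_def fun_eq_iff horizontal_zero[OF f])
      then have "insH h (cobd f) = 0"
        by (simp add: insH_cobd[OF p True] cobd_zero)
      then show ?thesis by (simp add: insH_def fun_eq_iff)
    qed (simp add: cobd_def)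
  qed
  have "cobd f es [] = 0" if "horizontal f" "set es \<inter> H \<noteq> {}" for es f
    using that
  proof (induction es arbitrary: f)
    case (Cons e es)
    have p: "precochain f" using Cons.prems by (simp add: horizontal_def)
    have "cobd f (e # es) [] = Lie e f es [] - cobd (insE e f) es []"
      using fun_cong[OF fun_cong[OF insE_cobd[OF p, of e], of es], of "[]"] by (simp add: insE_def)
    also have "\<dots> = 0"
    proof (cases "e \<in> H")
      case True
      then have "insE e f = 0"
        by (simp add: insE_def fun_eq_iff horizontal_zero[OF Cons.prems(1)])
      then show ?thesis using True by (simp add: Lie_horizontal[OF Cons.prems(1)] cobd_zero)
    next
      case False
      then show ?thesis
        using Cons.IH[OF horizontal_insE[OF Cons.prems(1)]] Cons.prems(2)
        by (simp add: Lie_horizontal[OF Cons.prems(1)])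
    qed
    finally show ?case .
  qed simp
  then show ?thesis
    using assms H0[OF assms] unfolding horizontal_def by (metis precochain_cobd)
qed

lemma basic_cobd: "basic n f \<Longrightarrow> basic (Suc n) (cobd f)"
  by (simp add: basic_def horizontal_cobd has_degree_cobd)

lemma horizontal_cong:
  assumes "horizontal f" and "map (\<lambda>x. x +o H) es = map (\<lambda>x. x +o H) es'"
  shows "f es hs = f es' hs"
  using assms
proof (induction es arbitrary: es' f)
  case (Cons e es)
  then obtain e' es'' where es': "es' = e' # es''" and e: "e - e' \<in> H"
    and es: "map (\<lambda>x. x +o H) es = map (\<lambda>x. x +o H) es''"
    by (auto simp: Cons_eq_map_conv coset_eq_iff)
  have p: "precochain f" using Cons.prems by (simp add: horizontal_def)
  have "insE (e' + (e - e')) f = insE e' f + insE (e - e') f" by (rule pre_addE[OF p])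
  also have "insE (e - e') f = 0"
    using e by (simp add: insE_def fun_eq_iff horizontal_zero[OF Cons.prems(1)])
  finally have "insE e f = insE e' f" by simp
  then show ?case
    using Cons.IH[OF horizontal_insE[OF Cons.prems(1), of e] es] es'
    by (simp add: insE_def fun_eq_iff)
qed simp

lemma horizontal_swap:
  assumes "horizontal f"
  shows "f (xs @ a # b # ys) hs = - f (xs @ b # a # ys) hs"
  using pre_skew[of f xs a b ys hs] horizontal_zero[OF assms] assms
  by (simp add: horizontal_def eq_neg_iff_add_eq_0)

lemma horizontal_move:
  assumes "horizontal f"
  shows "f (xs @ c # ys) hs = sV ((-1) ^ length xs) (f (c # xs @ ys) hs)"
proof (induction xs arbitrary: ys rule: rev_induct)
  case (snoc x xs)
  have "f ((xs @ [x]) @ c # ys) hs = - f (xs @ c # x # ys) hs"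
    using horizontal_swap[OF assms, of xs x c ys] by simp
  then show ?case by (simp add: snoc.IH)
qed simp

lemma eq_neg_self: "x = - x \<Longrightarrow> x = (0 :: 'v)"
proof -
  assume "x = - x"
  then have "x + x = 0" by (simp add: eq_neg_iff_add_eq_0)
  then have "sV 2 x = 0" using V.scale_left_distrib[of 1 1 x] by simp
  moreover have "2 \<noteq> (0 :: 'k)" using of_nat_eq_0[of 2] by auto
  ultimately show "x = 0" by simp
qed

text \<open>Without the correction term, exchanges only change the sign. They bring the two equal
  entries together, where the value equals its own negative.\<close>

lemma horizontal_repeated:
  assumes f: "horizontal f"
  shows "f (xs @ a # ys @ a # zs) hs = 0"
proof (induction ys arbitrary: xs)
  case Nil
  show ?case using horizontal_swap[OF f, of xs a a zs] by (simp add: eq_neg_self)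
next
  case (Cons y ys)
  show ?case
    using horizontal_swap[OF f, of xs a y "ys @ a # zs"] Cons.IH[of "xs @ [y]"] by simp
qed


section \<open>Chevalley-Eilenberg cochains as basic cochains\<close>

abbreviation LH :: "('k, 'l set) liealg" where "LH \<equiv> quotient_liealg sL br H"

abbreviation proj :: "'l \<Rightarrow> 'l set" where "proj x \<equiv> x +o H"

lemma LH_simps [simp]:
  "vcarrier LH = range proj" "vadd LH = (+)" "vsmult LH = coset_smult sL H"
  "lbracket LH = coset_bracket br H"
  by (simp_all add: quotient_liealg_def quotient_vspace_def vspace.extend_def liealg.fields_def)

lemma nlists_LH: "Xs \<in> nlists n (range proj) \<longleftrightarrow> (\<exists>es. length es = n \<and> Xs = map proj es)"
proof
  assume "Xs \<in> nlists n (range proj)"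
  then have "length Xs = n" "set Xs \<subseteq> range proj" by (auto simp: nlists_def)
  then show "\<exists>es. length es = n \<and> Xs = map proj es"
    using ex_map_conv[of Xs proj] by (metis length_map rangeE subsetD)
qed (auto simp: nlists_def)

lemma
  assumes \<phi>: "\<phi> \<in> CE_cochains LH sV n"
  shows CE_supp: "Xs \<notin> nlists n (range proj) \<Longrightarrow> \<phi> Xs = 0"
    and CE_add: "length (xs @ ys) = n - 1 \<Longrightarrow> 0 < n \<Longrightarrow> \<phi> (map proj xs @ proj (a + b) # map proj ys)
      = \<phi> (map proj xs @ proj a # map proj ys) + \<phi> (map proj xs @ proj b # map proj ys)"
    and CE_scale: "length (xs @ ys) = n - 1 \<Longrightarrow> 0 < n \<Longrightarrow> \<phi> (map proj xs @ proj (sL c a) # map proj ys)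
      = sV c (\<phi> (map proj xs @ proj a # map proj ys))"
    and CE_alt: "Xs \<in> nlists n (range proj) \<Longrightarrow> \<not> distinct Xs \<Longrightarrow> \<phi> Xs = 0"
proof -
  have *: "\<forall>Xs. Xs \<notin> nlists n (range proj) \<longrightarrow> \<phi> Xs = 0" "multilinear LH sV n \<phi>"
    "\<forall>Xs \<in> nlists n (range proj). \<not> distinct Xs \<longrightarrow> \<phi> Xs = 0"
    using \<phi> by (simp_all add: CE_cochains_def)
  show "Xs \<notin> nlists n (range proj) \<Longrightarrow> \<phi> Xs = 0"
    "Xs \<in> nlists n (range proj) \<Longrightarrow> \<not> distinct Xs \<Longrightarrow> \<phi> Xs = 0"
    using * by auto
  have m: "\<phi> (map proj xs @ proj (a + b) # map proj ys)
      = \<phi> (map proj xs @ proj a # map proj ys) + \<phi> (map proj xs @ proj b # map proj ys) \<and>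
     \<phi> (map proj xs @ proj (sL c a) # map proj ys)
      = sV c (\<phi> (map proj xs @ proj a # map proj ys))"
    if l: "length (xs @ ys) = n - 1" "0 < n" for xs ys a b c
  proof -
    let ?Xs = "map proj xs @ proj a # map proj ys"
    have "?Xs \<in> nlists n (range proj)" "length xs < n" using l by (auto simp: nlists_def)
    from *(2)[unfolded multilinear_def LH_simps, rule_format, OF this rangeI rangeI] have "\<phi> (?Xs[length xs := proj a + proj b])
        = \<phi> (?Xs[length xs := proj a]) + \<phi> (?Xs[length xs := proj b]) \<and>
      \<phi> (?Xs[length xs := coset_smult sL H c (proj a)]) = sV c (\<phi> (?Xs[length xs := proj a]))"
      by blast
    moreover have "?Xs[length xs := Y] = map proj xs @ Y # map proj ys" for Y
      using list_update_length[of "map proj xs"] by simp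
    ultimately show ?thesis by (simp add: coset_add coset_smult)
  qed
  show "length (xs @ ys) = n - 1 \<Longrightarrow> 0 < n \<Longrightarrow> \<phi> (map proj xs @ proj (a + b) # map proj ys)
      = \<phi> (map proj xs @ proj a # map proj ys) + \<phi> (map proj xs @ proj b # map proj ys)"
    "length (xs @ ys) = n - 1 \<Longrightarrow> 0 < n \<Longrightarrow> \<phi> (map proj xs @ proj (sL c a) # map proj ys)
      = sV c (\<phi> (map proj xs @ proj a # map proj ys))"
    using m by blast+
qed

definition pull :: "('l set list \<Rightarrow> 'v) \<Rightarrow> 'l list \<Rightarrow> 'l list \<Rightarrow> 'v" where
  "pull \<phi> = (\<lambda>es hs. if hs = [] then \<phi> (map proj es) else 0)"

lemma pull_add: "pull (\<phi> + \<psi>) = pull \<phi> + pull \<psi>"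
  and pull_diff: "pull (\<phi> - \<psi>) = pull \<phi> - pull \<psi>"
  and pull_scale: "pull (CE_scale sV c \<phi>) = scl c (pull \<phi>)"
  and pull_zero: "pull 0 = 0"
  by (auto simp: pull_def fun_eq_iff CE_scale_def scl_def)

lemma pull_inject:
  assumes "pull \<phi> = pull \<psi>"
    and "\<And>Xs. Xs \<notin> nlists n (range proj) \<Longrightarrow> \<phi> Xs = 0" "\<And>Xs. Xs \<notin> nlists n (range proj) \<Longrightarrow> \<psi> Xs = 0"
  shows "\<phi> = \<psi>"
proof
  fix Xs
  show "\<phi> Xs = \<psi> Xs"
  proof (cases "Xs \<in> nlists n (range proj)")
    case True
    then obtain es where "Xs = map proj es" by (auto simp: nlists_LH)
    then show ?thesis
      using fun_cong[OF fun_cong[OF assms(1), of es], of "[]"] by (simp add: pull_def)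
  qed (simp add: assms)
qed

lemma basic_pull:
  assumes \<phi>: "\<phi> \<in> CE_cochains LH sV n"
  shows "basic n (pull \<phi>)"
  unfolding basic_def horizontal_def
proof (intro conjI precochainI allI impI)
  have supp: "\<phi> (map proj es) = 0" if "length es \<noteq> n" for es
    using that by (intro CE_supp[OF \<phi>]) (auto simp: nlists_def)
  show "pull \<phi> es hs = 0" if "\<not> set hs \<subseteq> H" for es hs
    using that by (auto simp: pull_def)
  have "\<phi> (proj (a + b) # map proj es) = \<phi> (proj a # map proj es) + \<phi> (proj b # map proj es)"
    "\<phi> (proj (sL c a) # map proj es) = sV c (\<phi> (proj a # map proj es))" for a b c es
    using CE_add[OF \<phi>, of "[]" es a b] CE_scale[OF \<phi>, of "[]" es c a] supp[of "x # es" for x]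
    by (cases "length es = n - 1 \<and> 0 < n", simp, force)+
  then show "insE (a + b) (pull \<phi>) = insE a (pull \<phi>) + insE b (pull \<phi>)"
    "insE (sL c a) (pull \<phi>) = scl c (insE a (pull \<phi>))" for a b c
    by (simp_all add: insE_def pull_def scl_def fun_eq_iff)
  show "insH (a + b) (pull \<phi>) = insH a (pull \<phi>) + insH b (pull \<phi>)" for a b
    by (simp add: insH_def pull_def fun_eq_iff)
  show "insH (sL c a) (pull \<phi>) = scl c (insH a (pull \<phi>))" for c a
    by (simp add: insH_def pull_def scl_def fun_eq_iff)
  show "pull \<phi> es hs = pull \<phi> es hs'" if "mset hs = mset hs'" for es hs hs'
    using mset_eq_length[OF that] by (auto simp: pull_def)
  show "pull \<phi> (xs @ a # b # ys) hs + pull \<phi> (xs @ b # a # ys) hs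
      = - pull \<phi> (xs @ ys) (symprod br a b # hs)" for xs a b ys hs
  proof (cases "length (xs @ a # b # ys) = n")
    case True
    let ?F = "\<lambda>x y. \<phi> (map proj xs @ proj x # proj y # map proj ys)"
    have F1: "?F (x + x') y = ?F x y + ?F x' y" for x x' y
      using CE_add[OF \<phi>, of xs "y # ys" x x'] True by simp
    have F2: "?F x (y + y') = ?F x y + ?F x y'" for x y y'
      using CE_add[OF \<phi>, of "xs @ [x]" ys y y'] True by simp
    have F0: "?F x x = 0" for x
      using True by (intro CE_alt[OF \<phi>]) (auto simp: nlists_def)
    \<comment> \<open>Polarization of the alternating condition; the right-hand side of the exchange
      condition is zero because a pulled-back cochain has no symmetric component.\<close>
    have "?F a b + ?F b a = ?F (a + b) (a + b)"
      unfolding F1 F2 by (simp add: F0)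
    then show ?thesis by (simp add: pull_def F0)
  qed (auto simp: pull_def supp simp flip: list.map map_append)
  show "has_degree n (pull \<phi>)"
    using supp by (auto simp: has_degree_def pull_def)
  show "pull \<phi> es hs = 0" if d: "hs \<noteq> [] \<or> set es \<inter> H \<noteq> {}" for es hs
  proof (cases "hs = [] \<and> length es = n")
    case True
    then obtain h where h: "h \<in> H" and "h \<in> set es" using d by auto
    then obtain xs ys where es: "es = xs @ h # ys" by (auto dest: split_list)
    \<comment> \<open>The coset of \<open>h\<close> is the zero vector, written as a multiple by 0
      so that homogeneity applies.\<close>
    have "proj h = proj (sL 0 h)" unfolding coset_eq_iff using h by simp
    then have "\<phi> (map proj es) = sV 0 (\<phi> (map proj es))"
      using CE_scale[OF \<phi>, of xs ys 0 h] True by (auto simp: es)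
    then show ?thesis using True by (simp add: pull_def)
  qed (auto simp: pull_def supp)
qed

lemma basic_is_pull:
  assumes f: "basic n f"
  obtains \<phi> where "\<phi> \<in> CE_cochains LH sV n" "pull \<phi> = f"
proof
  have h: "horizontal f" and p: "precochain f" using f by (simp_all add: basic_def horizontal_def)
  \<comment> \<open>Arbitrary representatives of the cosets; \<open>horizontal_cong\<close> makes
    the value independent of the choice.\<close>
  define rep where "rep X = (SOME x. proj x = X)" for X
  have rep: "proj (rep (proj x)) = proj x" for x
    unfolding rep_def by (rule someI[of _ x]) simp
  define \<phi> where "\<phi> Xs = (if Xs \<in> nlists n (range proj) then f (map rep Xs) [] else 0)" for Xs
  have \<phi>: "\<phi> (map proj es) = f es []" for es
  proof (cases "length es = n")
    case True
    have "f (map rep (map proj es)) [] = f es []"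
      by (rule horizontal_cong[OF h]) (simp add: rep)
    then show ?thesis using True by (auto simp: \<phi>_def nlists_def)
  next
    case False
    then show ?thesis using has_degreeD[OF basicD(2)[OF f]] by (simp add: \<phi>_def nlists_def)
  qed
  show "pull \<phi> = f"
    using horizontal_zero[OF h] by (auto simp: pull_def \<phi> fun_eq_iff)
  show "\<phi> \<in> CE_cochains LH sV n"
    unfolding CE_cochains_def multilinear_def LH_simps
  proof (intro CollectI conjI allI ballI impI)
    show "\<phi> Xs = 0" if "Xs \<notin> nlists n (range proj)" for Xs
      using that by (simp add: \<phi>_def)
  next
    fix Xs i X Y c
    assume "Xs \<in> nlists n (range proj)" and i: "i < n" and "X \<in> range proj" "Y \<in> range proj"
    then obtain es x y where es: "length es = n" "Xs = map proj es" "X = proj x" "Y = proj y"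
      by (auto simp: nlists_LH)
    have u: "(map proj es)[i := proj z] = map proj (es[i := z])" for z by (simp add: map_update)
    from es show "\<phi> (Xs[i := X + Y]) = \<phi> (Xs[i := X]) + \<phi> (Xs[i := Y])"
      "\<phi> (Xs[i := coset_smult sL H c X]) = sV c (\<phi> (Xs[i := X]))"
      using i pre_add_nth[OF p] pre_scale_nth[OF p]
      by (simp_all add: coset_add coset_smult u \<phi>)
  next
    fix Xs assume "Xs \<in> nlists n (range proj)" "\<not> distinct Xs"
    then obtain es ws X ys zs where "Xs = map proj es" "Xs = ws @ [X] @ ys @ [X] @ zs"
      using not_distinct_decomp by (metis nlists_LH)
    then obtain us x vs x' ws' where es: "es = us @ x # vs @ x' # ws'" "proj x = proj x'"
      by (auto simp: map_eq_append_conv Cons_eq_map_conv map_eq_Cons_conv append_eq_map_conv)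
    \<comment> \<open>Equal cosets may have different representatives \<open>x\<close> and
      \<open>x'\<close>, which have to be made equal before the repetition argument applies.\<close>
    have "f es [] = f (us @ x # vs @ x # ws') []"
      by (rule horizontal_cong[OF h]) (simp add: es)
    then show "\<phi> Xs = 0"
      using \<open>Xs = map proj es\<close> by (simp only: \<phi> horizontal_repeated[OF h])
  qed
qed

text \<open>Without symmetric arguments only \<open>d_0\<close> survives. It differs from the
  Chevalley-Eilenberg formula in that the bracket stands in the place of its right factor instead of
  in front.\<close>

lemma pull_CE_diff:
  assumes \<phi>: "\<phi> \<in> CE_cochains LH sV n"
  shows "cobd (pull \<phi>) = pull (CE_diff LH sV (induced_rep \<tau>) n \<phi>)"
proof (intro ext)
  fix es hs :: "'l list"
  let ?f = "pull \<phi>"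
  have h: "horizontal ?f" using basic_pull[OF \<phi>] by (simp add: basic_def)
  have b: "basic (Suc n) (cobd ?f)" by (rule basic_cobd[OF basic_pull[OF \<phi>]])
  show "cobd ?f es hs = pull (CE_diff LH sV (induced_rep \<tau>) n \<phi>) es hs"
  proof (cases "hs = [] \<and> length es = Suc n")
    case True
    have 2: "sV ((-1) ^ Suc a) (?f (omit a (es[b := br (es ! a) (es ! b)])) [])
        = sV ((-1) ^ (a + b)) (\<phi> (proj (br (es ! a) (es ! b)) # map proj (omit a (omit b es))))"
      if ab: "a < b" "b < Suc n" for a b
    proof -
      \<comment> \<open>As entry \<open>a\<close> is omitted, only \<open>b - 1\<close> entries
        precede the bracket; moving it past them turns the sign exponent \<open>a + 1\<close> into
        \<open>a + b\<close>.\<close>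
      have l: "length (omit a (take b es)) = b - 1"
        using ab True by (simp add: length_omit)
      have "?f (omit a (es[b := c])) [] = sV ((-1) ^ (b - 1)) (?f (c # omit a (omit b es)) [])" for c
        using omit_update(1)[of a b es c] omit_update(2)[of a b es] ab True
          horizontal_move[OF h, of "omit a (take b es)" c "drop (Suc b) es" "[]"] by (simp add: l)
      moreover have "Suc a + (b - 1) = a + b" using ab by simp
      ultimately show ?thesis
        by (simp add: pull_def flip: power_add del: power_Suc)
    qed
    have "(\<Sum>b<Suc n. \<Sum>a<b. sV ((-1) ^ Suc a) (?f (omit a (es[b := br (es ! a) (es ! b)])) []))
       = (\<Sum>b<Suc n. \<Sum>a<b. sV ((-1) ^ (a + b))
            (\<phi> (proj (br (es ! a) (es ! b)) # map proj (omit a (omit b es)))))"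
      by (intro sum.cong refl 2) auto
    also have "\<dots> = (\<Sum>b<Suc n. \<Sum>a<b. sV ((-1) ^ (a + b))
            (\<phi> (coset_bracket br H (map proj es ! a) (map proj es ! b)
              # omit a (omit b (map proj es)))))"
      using True by (intro sum.cong refl) (simp add: coset_bracket omit_map)
    finally have B: "(\<Sum>b<Suc n. \<Sum>a<b. sV ((-1) ^ Suc a) (?f (omit a (es[b := br (es ! a) (es ! b)])) []))
       = \<dots>" .
    have A: "(\<Sum>a<Suc n. sV ((-1) ^ a) (\<tau> (es ! a) (?f (omit a es) [])))
      = (\<Sum>a<Suc n. sV ((-1) ^ a) (induced_rep \<tau> (map proj es ! a) (\<phi> (omit a (map proj es)))))"
      using True by (intro sum.cong refl) (simp add: omit_map induced_rep_coset pull_def)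
    have "map proj es \<in> nlists (Suc n) (range proj)" using True by (auto simp: nlists_def)
    then have "pull (CE_diff LH sV (induced_rep \<tau>) n \<phi>) es hs
      = (\<Sum>a<Suc n. sV ((-1) ^ a) (\<tau> (es ! a) (?f (omit a es) []))) +
        (\<Sum>b<Suc n. \<Sum>a<b. sV ((-1) ^ Suc a) (?f (omit a (es[b := br (es ! a) (es ! b)])) []))"
      unfolding A B using True by (simp only: pull_def CE_diff_def LH_simps simp_thms if_True)
    then show ?thesis
      using True unfolding cobd_def by simp
  next
    case False
    then have "cobd ?f es hs = 0"
      using b horizontal_zero[of "cobd ?f" hs es] has_degreeD[of "Suc n" "cobd ?f" es hs]
      unfolding basic_def by (cases "hs = []") simp_all
    moreover have "map proj es \<notin> nlists (Suc n) (range proj) \<or> hs \<noteq> []"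
      using False by (auto simp: nlists_def)
    ultimately show ?thesis
      by (auto simp: pull_def CE_diff_def)
  qed
qed

text \<open>Alternation comes for free: the differential of a pulled-back cochain is basic, hence
  itself pulled back from a cochain, and pulling back is injective.\<close>

lemma CE_diff_cochain:
  assumes \<phi>: "\<phi> \<in> CE_cochains LH sV n"
  shows "CE_diff LH sV (induced_rep \<tau>) n \<phi> \<in> CE_cochains LH sV (Suc n)"
proof -
  obtain \<psi> where \<psi>: "\<psi> \<in> CE_cochains LH sV (Suc n)" "pull \<psi> = cobd (pull \<phi>)"
    using basic_is_pull[OF basic_cobd[OF basic_pull[OF \<phi>]]] by blast
  have "CE_diff LH sV (induced_rep \<tau>) n \<phi> = \<psi>"
    using \<psi>(2) CE_supp[OF \<psi>(1)] pull_CE_diff[OF \<phi>]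
    by (intro pull_inject[of _ _ "Suc n"]) (simp_all add: CE_diff_def)
  then show ?thesis using \<psi>(1) by simp
qed


section \<open>Cocycles, coboundaries and the comparison of cohomologies\<close>

lemma CE_cochains_iff:
  "\<phi> \<in> CE_cochains LH sV n \<longleftrightarrow>
    basic n (pull \<phi>) \<and> (\<forall>Xs. Xs \<notin> nlists n (range proj) \<longrightarrow> \<phi> Xs = 0)"
proof (intro iffI conjI)
  assume r: "basic n (pull \<phi>) \<and> (\<forall>Xs. Xs \<notin> nlists n (range proj) \<longrightarrow> \<phi> Xs = 0)"
  then obtain \<psi> where \<psi>: "\<psi> \<in> CE_cochains LH sV n" "pull \<psi> = pull \<phi>"
    using basic_is_pull by blast
  have "\<psi> = \<phi>"
    using r CE_supp[OF \<psi>(1)] by (intro pull_inject[OF \<psi>(2)]) auto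
  then show "\<phi> \<in> CE_cochains LH sV n" using \<psi>(1) by simp
qed (auto simp: basic_pull CE_supp)

lemma basic_add: "basic n f \<Longrightarrow> basic n g \<Longrightarrow> basic n (f + g)"
  and basic_diff: "basic n f \<Longrightarrow> basic n g \<Longrightarrow> basic n (f - g)"
  and basic_zero: "basic n 0"
  by (auto simp: basic_def horizontal_def has_degree_add has_degree_diff has_degree_zero
      precochain_add precochain_diff precochain_zero)

lemma CE_cocycles_iff:
  "\<phi> \<in> cocycles (CE_cochains LH sV) (CE_diff LH sV (induced_rep \<tau>)) n \<longleftrightarrow>
    basic n (pull \<phi>) \<and> (\<forall>Xs. Xs \<notin> nlists n (range proj) \<longrightarrow> \<phi> Xs = 0) \<and> cobd (pull \<phi>) = 0"
proof -
  have "CE_diff LH sV (induced_rep \<tau>) n \<phi> = 0 \<longleftrightarrow> cobd (pull \<phi>) = 0" if "\<phi> \<in> CE_cochains LH sV n"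
  proof
    assume "cobd (pull \<phi>) = 0"
    then have "pull (CE_diff LH sV (induced_rep \<tau>) n \<phi>) = pull 0"
      by (simp add: pull_CE_diff[OF that] pull_zero)
    then show "CE_diff LH sV (induced_rep \<tau>) n \<phi> = 0"
      by (rule pull_inject[of _ _ "Suc n"]) (simp_all add: CE_diff_def)
  qed (simp add: pull_CE_diff[OF that] pull_zero)
  then show ?thesis unfolding cocycles_def CE_cochains_iff by blast
qed

text \<open>Coboundaries before \<open>pack\<close>, in the form that
  \<open>basic_decomposition\<close> delivers; the case distinction leaves only 0 in degree
  0.\<close>

definition bounds :: "nat \<Rightarrow> ('l list \<Rightarrow> 'l list \<Rightarrow> 'v) set" where
  "bounds n = {cobd g | g. precochain g \<and> (case n of 0 \<Rightarrow> g = 0 | Suc m \<Rightarrow> has_degree m g)}"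

lemma bounds_diff: assumes "f \<in> bounds n" "g \<in> bounds n" shows "f - g \<in> bounds n"
proof -
  obtain a b where ab: "f = cobd a" "g = cobd b" "precochain a" "precochain b"
    "case n of 0 \<Rightarrow> a = 0 | Suc m \<Rightarrow> has_degree m a" "case n of 0 \<Rightarrow> b = 0 | Suc m \<Rightarrow> has_degree m b"
    using assms unfolding bounds_def by blast
  then have "case n of 0 \<Rightarrow> a - b = 0 | Suc m \<Rightarrow> has_degree m (a - b)"
    by (cases n) (simp_all add: has_degree_diff)
  then show ?thesis
    unfolding bounds_def ab(1,2) cobd_diff[symmetric] using precochain_diff[OF ab(3,4)] by blast
qed

lemma bounds_scl: assumes "f \<in> bounds n" shows "scl c f \<in> bounds n"
proof -
  obtain a where a: "f = cobd a" "precochain a" "case n of 0 \<Rightarrow> a = 0 | Suc m \<Rightarrow> has_degree m a"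
    using assms unfolding bounds_def by blast
  then have "case n of 0 \<Rightarrow> scl c a = 0 | Suc m \<Rightarrow> has_degree m (scl c a)"
    by (cases n) (simp_all add: has_degree_scl scl_zero)
  then show ?thesis
    unfolding bounds_def a(1) cobd_scl[symmetric] using precochain_scl[OF a(2)] by blast
qed

lemma H_cocycles:
  "cocycles (Hcochains sL br H sV) (Hdiff br H sV \<tau>) n
    = pack ` {f. precochain f \<and> has_degree n f \<and> cobd f = 0}"
proof -
  have "pack f = 0 \<longleftrightarrow> f = 0" for f
    by (metis pack_zero unpack_pack)
  then show ?thesis
    unfolding cocycles_def Hcochains_eq by (auto simp: Hdiff_pack)
qed

lemma H_coboundaries:
  "coboundaries (Hcochains sL br H sV) (Hdiff br H sV \<tau>) n = pack ` bounds n"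
proof (cases n)
  case 0
  then show ?thesis by (auto simp: coboundaries_def bounds_def cobd_zero pack_zero precochain_zero)
next
  case (Suc m)
  then show ?thesis
    by (auto simp: coboundaries_def bounds_def Hcochains_eq Hdiff_pack image_image intro!: image_eqI)
qed

text \<open>This is injectivity on cohomology. If \<open>pull \<phi> = cobd g\<close>, then
  \<open>g\<close> has basic differential and can be replaced by its basic part, which comes from a
  cochain of the quotient.\<close>

lemma CE_coboundaries:
  "coboundaries (CE_cochains LH sV) (CE_diff LH sV (induced_rep \<tau>)) n
    = {\<phi> \<in> cocycles (CE_cochains LH sV) (CE_diff LH sV (induced_rep \<tau>)) n. pull \<phi> \<in> bounds n}"
    (is "?B = {\<phi> \<in> ?Z. _}")
proof (cases n)
  case 0
  have "\<phi> = 0" if "\<phi> \<in> ?Z" "pull \<phi> = 0" for \<phi>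
    using that by (intro pull_inject[of _ _ n]) (auto simp: pull_zero CE_cocycles_iff)
  moreover have "0 \<in> ?Z" by (simp add: CE_cocycles_iff pull_zero basic_zero cobd_zero)
  moreover have "?B = {0}" "bounds n = {0}"
    using 0 by (auto simp: coboundaries_def bounds_def cobd_zero precochain_zero)
  ultimately show ?thesis by (auto simp: pull_zero)
next
  case (Suc m)
  let ?d = "CE_diff LH sV (induced_rep \<tau>) m"
  have B: "?B = ?d ` CE_cochains LH sV m" by (simp add: Suc coboundaries_def)
  show ?thesis
  proof (intro equalityI subsetI)
    fix \<phi> assume "\<phi> \<in> ?B"
    then obtain \<psi> where \<psi>: "\<psi> \<in> CE_cochains LH sV m" "\<phi> = ?d \<psi>" unfolding B by blast
    note b = basic_pull[OF \<psi>(1)]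
    have "\<phi> \<in> CE_cochains LH sV n" using CE_diff_cochain[OF \<psi>(1)] by (simp add: Suc \<psi>(2))
    moreover have e: "pull \<phi> = cobd (pull \<psi>)" by (simp only: \<psi>(2) pull_CE_diff[OF \<psi>(1)])
    then have "cobd (pull \<phi>) = 0" by (simp add: cobd_cobd basicD[OF b])
    ultimately show "\<phi> \<in> {\<phi> \<in> ?Z. pull \<phi> \<in> bounds n}"
      using basicD[OF b] e by (auto simp: CE_cocycles_iff CE_cochains_iff bounds_def Suc)
  next
    fix \<phi> assume \<phi>: "\<phi> \<in> {\<phi> \<in> ?Z. pull \<phi> \<in> bounds n}"
    then obtain g where g: "precochain g" "has_degree m g" "pull \<phi> = cobd g"
      by (auto simp: bounds_def Suc)
    have c: "\<phi> \<in> CE_cochains LH sV n" using \<phi> by (simp add: cocycles_def)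
    have "basic (Suc m) (cobd g)" using basic_pull[OF c] by (simp add: Suc g(3))
    then obtain a g' where a: "basic m a" and g': "precochain g'" "g = a + cobd g'"
      using basic_decomposition[OF g(1,2)] by metis
    obtain \<psi> where \<psi>: "\<psi> \<in> CE_cochains LH sV m" "pull \<psi> = a" using basic_is_pull[OF a] by blast
    have "pull \<phi> = pull (?d \<psi>)"
      by (simp add: g(3) g'(2) cobd_add cobd_cobd[OF g'(1)] \<psi>(2) flip: pull_CE_diff[OF \<psi>(1)])
    then have "\<phi> = ?d \<psi>"
      using CE_supp[OF c] by (intro pull_inject[of _ _ n]) (auto simp: CE_diff_def Suc)
    then show "\<phi> \<in> ?B" using \<psi>(1) by (simp add: B)
  qed
qed

lemma cohomology_isomorphic:
  "vspace_isomorphic (H_standard_cohomology sL br H sV \<tau> n) (CE_cohomology LH sV (induced_rep \<tau>) n)"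
  unfolding H_standard_cohomology_def CE_cohomology_def cohomology_def
proof (rule quotient_vspace_isomorphic[where T = "\<lambda>\<phi>. pack (pull \<phi>)"])
  let ?Z = "cocycles (CE_cochains LH sV) (CE_diff LH sV (induced_rep \<tau>)) n"
  let ?A = "cocycles (Hcochains sL br H sV) (Hdiff br H sV \<tau>) n"
  let ?B = "coboundaries (Hcochains sL br H sV) (Hdiff br H sV \<tau>) n"
  have pack_iff: "pack f \<in> pack ` S \<longleftrightarrow> f \<in> S" for f S
    by (metis image_iff unpack_pack)
  show "0 \<in> ?B"
    unfolding H_coboundaries bounds_def
    by (rule image_eqI[of _ _ 0]) (auto simp: pack_zero precochain_zero has_degree_zero cobd_zero
      split: nat.split intro!: exI[of _ 0])
  show "x - y \<in> ?B" if "x \<in> ?B" "y \<in> ?B" for x y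
    using that unfolding H_coboundaries by (auto simp: pack_iff bounds_diff simp flip: pack_minus)
  show "Hscale sV c x \<in> ?B" if "x \<in> ?B" for c x
    using that unfolding H_coboundaries by (auto simp: pack_iff bounds_scl simp flip: pack_scl)
  show "x + y \<in> ?Z" if "x \<in> ?Z" "y \<in> ?Z" for x y
    using that by (simp add: CE_cocycles_iff pull_add basic_add cobd_add)
  show "x - y \<in> ?Z" if "x \<in> ?Z" "y \<in> ?Z" for x y
    using that by (simp add: CE_cocycles_iff pull_diff basic_diff cobd_diff)
  show "CE_scale sV c x \<in> ?Z" if "x \<in> ?Z" for c x
    using that by (simp add: CE_cocycles_iff pull_scale basic_scl cobd_scl scl_zero) (simp add: CE_scale_def)
  show "0 \<in> ?Z"
    by (simp add: CE_cocycles_iff pull_zero basic_zero cobd_zero)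
  show "Hscale sV c (x + y) = Hscale sV c x + Hscale sV c y" for c x y
    by (simp add: Hscale_def fun_eq_iff V.scale_right_distrib)
  show "CE_scale sV c (x + y) = CE_scale sV c x + CE_scale sV c y" for c x y
    by (simp add: CE_scale_def fun_eq_iff V.scale_right_distrib)
  show "pack (pull (x + y)) = pack (pull x) + pack (pull y)" for x y
    by (simp add: pull_add pack_add)
  show "pack (pull (CE_scale sV c x)) = Hscale sV c (pack (pull x))" for c x
    by (simp add: pull_scale pack_scl)
  show "pack (pull x) \<in> ?A" if "x \<in> ?Z" for x
    using that unfolding H_cocycles by (auto simp: CE_cocycles_iff dest: basicD)
  show "coboundaries (CE_cochains LH sV) (CE_diff LH sV (induced_rep \<tau>)) n
      = {x \<in> ?Z. pack (pull x) \<in> ?B}"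
    unfolding CE_coboundaries H_coboundaries pack_iff ..
  \<comment> \<open>Surjectivity on cohomology: the differential of a cocycle is 0 and hence basic,
    and the basic part in its decomposition is again a cocycle since \<open>d\<close> squares to
    zero.\<close>
  show "\<exists>x\<in>?Z. a - pack (pull x) \<in> ?B" if aA: "a \<in> ?A" for a
  proof -
    obtain f where f: "precochain f" "has_degree n f" "cobd f = 0" and a: "a = pack f"
      using aA unfolding H_cocycles by blast
    have "basic (Suc n) (cobd f)" unfolding f(3) by (rule basic_zero)
    then obtain b g where b: "basic n b" and g: "precochain g"
      "case n of 0 \<Rightarrow> g = 0 | Suc m \<Rightarrow> has_degree m g" "f = b + cobd g"
      using basic_decomposition[OF f(1,2)] by metis
    obtain \<phi> where \<phi>: "\<phi> \<in> CE_cochains LH sV n" "pull \<phi> = b" using basic_is_pull[OF b] by blast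
    have "cobd b = 0" using f(3) by (simp add: g(3) cobd_add cobd_cobd[OF g(1)])
    then have "\<phi> \<in> ?Z" using b \<phi> by (simp add: CE_cocycles_iff CE_cochains_iff)
    moreover have "a - pack (pull \<phi>) = pack (cobd g)"
      by (simp add: a g(3) \<phi>(2) flip: pack_minus)
    moreover have "cobd g \<in> bounds n" using g(1,2) by (auto simp: bounds_def)
    ultimately show ?thesis unfolding H_coboundaries by auto
  qed
qed

end

theorem theorem5p6:
  fixes sL :: "'k::real_or_complex \<Rightarrow> 'l::ab_group_add \<Rightarrow> 'l"
    and br :: "'l \<Rightarrow> 'l \<Rightarrow> 'l"
    and H :: "'l set"
    and sV :: "'k \<Rightarrow> 'v::ab_group_add \<Rightarrow> 'v"
    and \<tau> :: "'l \<Rightarrow> 'v \<Rightarrow> 'v"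
  assumes "leibniz_algebra sL br"
    and "isotropic_ideal sL br H"
    and "left_center br \<subseteq> H"
    and "H_representation sL br H sV \<tau>"
  shows "\<forall>n. vspace_isomorphic
           (H_standard_cohomology sL br H sV \<tau> n)
           (CE_cohomology (quotient_liealg sL br H) sV (induced_rep \<tau>) n)"
proof -
  interpret leibniz_cartan sL br H sV \<tau>
    using assms(3,4) real_or_complex_of_nat_eq_0
    by (intro leibniz_cartan.intro leibniz_cartan_axioms.intro)
  show ?thesis using cohomology_isomorphic by blast
qed

end
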